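(* Let $(c_h^{n},\mu_h^{n})$, $n\ge 0$, be generated by the fully discrete scheme: $c_h^0=\pi_h c(t^0)\in V_h$ and, given $c_h^n\in V_h$, the pair $(c_h^{n+1},\mu_h^{n+1})\in V_h\times V_h$ satisfies, for all $(v_h,q_h)\in V_h\times V_h$, $$\Bigl(\frac{c_h^{n+1}-c_h^{n}}{\tau},v_h\Bigr)_{\Gamma_h}=-M\,a_h(\mu_h^{n+1},v_h),$$ $$(\mu_h^{n+1},q_h)_{\Gamma_h}=\beta_s\tau\Bigl(\frac{c_h^{n+1}-c_h^{n}}{\tau},q_h\Bigr)_{\Gamma_h}+(f_0'(c_h^{n}),q_h)_{\Gamma_h}+\epsilon^2a_h(c_h^{n+1},q_h).$$ Let $$E_h^{n}=\frac{\epsilon^2}{2}a_h(c_h^{n},c_h^{n})+\int_{\Gamma_h}f_0(c_h^{n})\,ds$$ be the modified discrete energy and let $\delta c_h^{n+1}=c_h^{n+1}-c_h^{n}$. If $$\beta_s\ge\frac{L}{2},$$ then the scheme obeys the energy dissipation law $$E_h^{n+1}-E_h^{n}+\frac{\epsilon^2}{2}a_h(\delta c_h^{n+1},\delta c_h^{n+1})+M\tau\,a_h(\mu_h^{n+1},\mu_h^{n+1})\le 0 .$$ In particular, the scheme is energy stable in the sense that $E_h^{n+1}\le E_h^{n}$ for all $n=0,1,2,\dots$.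
   Context: **Surface and mesh.** $\Gamma\subset\mathbb{R}^3$ is a closed, sufficiently smooth surface contained in a bulk domain $\Omega\subset\mathbb{R}^3$, and $\Gamma=\{x\in\Omega:\phi(x)=0\}$ for a sufficiently smooth (at least Lipschitz) level set function $\phi$ with $|\nabla\phi|\ge c_0>0$ in a neighborhood $\mathcal{O}(\Gamma)$ of $\Gamma$. $\mathcal{T}_h$ is a shape-regular, quasi-uniform triangulation of $\Omega$ into tetrahedra, with mesh size $h$, not fitted to $\Gamma$. For an integer $q\ge1$, $\phi_h$ is the Lagrange interpolant of $\phi$ in the space of continuous piecewise polynomials of degree $\le q$ on $\mathcal{T}_h$, and $\Gamma_h$ is the zero level set of $\phi_h$. Set $\mathbf{n}_h=\nabla\phi_h/|\nabla\phi_h|$, $\mathbf{P}_h=I-\mathbf{n}_h\mathbf{n}_h^{T}$ and $\nabla_{\Gamma_h}v=\mathbf{P}_h\nabla v$. $\mathcal{T}_h^\Gamma$ is the set of tetrahedra of $\mathcal{T}_h$ having nonzero intersection with $\Gamma_h$, and $\Omega_h^\Gamma$ is the domain formed by them. **Finite element space and forms.** For an integer $m\ge1$, $V_h=\{w\in C(\Omega_h^\Gamma): w|_T\in\mathcal{P}_m(T)\ \forall\,T\in\mathcal{T}_h^\Gamma\}$. $(\cdot,\cdot)_{\Gamma_h}$ is the $L^2(\Gamma_h)$ inner product. The stabilized bilinear form is $$a_h(u,v)=(\nabla_{\Gamma_h}u,\nabla_{\Gamma_h}v)_{\Gamma_h}+h\int_{\Omega_h^\Gamma}(\mathbf{n}_h\cdot\nabla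 u)(\mathbf{n}_h\cdot\nabla v)\,dx .$$ **Initial datum.** $c(t^0)$ is the initial concentration of the surface Cahn--Hilliard problem on $\Gamma$. For $v\in H^1(\Gamma)$, $\pi_hv\in V_h$ is the stabilized Ritz projection defined by $a_h(\pi_hv,w_h)=\int_\Gamma\nabla_\Gamma v\cdot\nabla_\Gamma w_h^\ell\,ds$ for all $w_h\in V_h$ and $(\pi_hv-v^e,1)_{\Gamma_h}=0$. Here $v^e(x)=v(\mathbf{p}(x))$, $\mathbf{p}$ is the closest point projection onto $\Gamma$, and $w_h^\ell$ is the lift to $\Gamma$ of $w_h|_{\Gamma_h}$, i.e. $w_h^\ell(\mathbf{p}(x))=w_h(x)$ for $x\in\Gamma_h$. **Parameters.** $\tau>0$ is the time step, $M=1$ is the constant mobility (the symbol $M$ is kept in the formulas), $\epsilon>0$ is the interface width parameter, and $\beta_s$ is a real stabilization parameter. **Potential.** For a fixed $K>1$, $f_0$ is the regularized double-well potential $$f_0(c)=\begin{cases}\frac14(c^2-1)^2,& c\in[-K,K],\\ \frac12(3K^2-1)c^2-2K^3c+\frac14(3K^4+1),& c>K,\\ \frac12(3K^2-1)c^2+2K^3c+\frac14(3K^4+1),& c<-K,\end{cases}$$ and $L=3K^2-1$. One has $\max_{x\in\mathbb{R}}|f_0''(x)|\le L$. *)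

theory Defs
  imports "HOL-Analysis.Analysis"
begin

section \<open>Two-dimensional Hausdorff measure\<close>

text \<open>The surface integrals over \<open>\<Gamma>\<close> and \<open>\<Gamma>\<^sub>h\<close> are integrals against the
  two-dimensional Hausdorff measure; the factor \<open>\<pi>/4\<close> is the area of a disc of diameter 1, so that
  the measure of a surface is its area. Covering sets are required to be bounded because
  \<^const>\<open>diameter\<close> is unspecified on unbounded sets.\<close>

definition hausdorff2_pre :: "real \<Rightarrow> 'a::metric_space set \<Rightarrow> ennreal" where
  "hausdorff2_pre d A =
     (INF C\<in>{C :: nat \<Rightarrow> 'a set. A \<subseteq> (\<Union>i. C i) \<and> (\<forall>i. bounded (C i) \<and> diameter (C i) \<le> d)}.
        \<Sum>i. ennreal (pi / 4 * (diameter (C i))\<^sup>2))"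

definition hausdorff2_outer :: "'a::metric_space set \<Rightarrow> ennreal" where
  "hausdorff2_outer A = (SUP d\<in>{0<..}. hausdorff2_pre d A)"

definition hausdorff2 :: "'a::metric_space measure" where
  "hausdorff2 = measure_of UNIV (sets borel) hausdorff2_outer"

lemma space_hausdorff2 [simp]: "space hausdorff2 = UNIV"
  by (simp add: hausdorff2_def)

lemma sets_hausdorff2 [simp, measurable_cong]: "sets hausdorff2 = sets borel"
  unfolding hausdorff2_def by (metis sets.sets_measure_of_eq space_borel)

lemma hausdorff2_pre_mono: "A \<subseteq> B \<Longrightarrow> hausdorff2_pre d A \<le> hausdorff2_pre d B"
  unfolding hausdorff2_pre_def by (rule INF_superset_mono) auto

lemma hausdorff2_pre_antimono: "d \<le> e \<Longrightarrow> hausdorff2_pre e A \<le> hausdorff2_pre d A"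
  unfolding hausdorff2_pre_def by (rule INF_superset_mono) (auto intro: order_trans)

lemma hausdorff2_pre_le_outer: "0 < d \<Longrightarrow> hausdorff2_pre d A \<le> hausdorff2_outer A"
  unfolding hausdorff2_outer_def by (rule SUP_upper) auto

lemma hausdorff2_outer_mono: "A \<subseteq> B \<Longrightarrow> hausdorff2_outer A \<le> hausdorff2_outer B"
  unfolding hausdorff2_outer_def by (rule SUP_mono) (auto intro: hausdorff2_pre_mono)

lemma hausdorff2_outer_empty [simp]: "hausdorff2_outer {} = 0"
proof -
  have "hausdorff2_pre d ({} :: 'a set) \<le> 0" if "0 < d" for d
    unfolding hausdorff2_pre_def
    by (rule INF_lower2[of "\<lambda>_. {}"]) (use that in auto)
  then show ?thesis
    unfolding hausdorff2_outer_def by (auto simp: SUP_eq_iff le_zero_eq intro!: antisym SUP_least)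
qed

lemma hausdorff2_outer_SUP_nat:
  "hausdorff2_outer A = (SUP n. hausdorff2_pre (1 / real (Suc n)) A)"
proof (rule antisym)
  show "hausdorff2_outer A \<le> (SUP n. hausdorff2_pre (1 / real (Suc n)) A)"
    unfolding hausdorff2_outer_def
  proof (rule SUP_least)
    fix d :: real assume "d \<in> {0<..}"
    then obtain n where "1 / real (Suc n) < d"
      using nat_approx_posE[of d] by auto
    then have "hausdorff2_pre d A \<le> hausdorff2_pre (1 / real (Suc n)) A"
      by (intro hausdorff2_pre_antimono) simp
    then show "hausdorff2_pre d A \<le> (SUP n. hausdorff2_pre (1 / real (Suc n)) A)"
      by (rule order_trans) (rule SUP_upper, simp)
  qed
  show "(SUP n. hausdorff2_pre (1 / real (Suc n)) A) \<le> hausdorff2_outer A"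
    by (rule SUP_least) (rule hausdorff2_pre_le_outer, simp)
qed

lemma hausdorff2_pre_UN:
  "hausdorff2_pre d (\<Union>n. A n) \<le> (\<Sum>n. hausdorff2_pre d (A n :: 'a::metric_space set))"
proof (rule ennreal_le_epsilon)
  fix e :: real
  assume fin: "(\<Sum>n. hausdorff2_pre d (A n)) < top" and e: "0 < e"
  let ?s = "\<lambda>C :: nat \<Rightarrow> 'a set. \<Sum>i. ennreal (pi / 4 * (diameter (C i))\<^sup>2)"
  let ?e = "\<lambda>n. ennreal (e * (1/2)^Suc n)"
  have fin': "hausdorff2_pre d (A n) \<noteq> top" for n
    using fin by (metis ennreal_suminf_lessD less_top)
  have "\<exists>C. A n \<subseteq> (\<Union>i. C i) \<and> (\<forall>i. bounded (C i) \<and> diameter (C i) \<le> d) \<and>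
          ?s C \<le> hausdorff2_pre d (A n) + ?e n" for n
  proof -
    have "hausdorff2_pre d (A n) < hausdorff2_pre d (A n) + ?e n"
      using ennreal_add_left_cancel_less[of "hausdorff2_pre d (A n)" 0 "?e n"] fin'[of n] e by simp
    then show ?thesis
      unfolding hausdorff2_pre_def[of d "A n"] INF_less_iff
      by (auto intro: less_imp_le)
  qed
  then obtain C where C: "\<And>n. A n \<subseteq> (\<Union>i. C n i)"
      "\<And>n i. bounded (C n i)" "\<And>n i. diameter (C n i) \<le> d"
      "\<And>n. ?s (C n) \<le> hausdorff2_pre d (A n) + ?e n"
    by metis
  let ?D = "\<lambda>k. case prod_decode k of (n, i) \<Rightarrow> C n i"
  have cov: "(\<Union>n. A n) \<subseteq> (\<Union>k. ?D k)"
  proof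
    fix x assume "x \<in> (\<Union>n. A n)"
    then obtain n i where "x \<in> C n i" using C(1) by blast
    then have "x \<in> ?D (prod_encode (n, i))" by simp
    then show "x \<in> (\<Union>k. ?D k)" by (rule UN_I[OF UNIV_I])
  qed
  have "hausdorff2_pre d (\<Union>n. A n) \<le> ?s ?D"
    unfolding hausdorff2_pre_def
  proof (rule INF_lower, intro CollectI conjI allI)
    show "bounded (?D k)" "diameter (?D k) \<le> d" for k
      by (simp_all add: case_prod_unfold C(2,3))
  qed (rule cov)
  also have "?s ?D = (\<Sum>n. ?s (C n))"
    by (rule suminf_ennreal_2dimen[where f = "\<lambda>z. ennreal (pi / 4 * (diameter (case_prod C z))\<^sup>2)"])
      (simp only: prod.case)
  also have "\<dots> \<le> (\<Sum>n. hausdorff2_pre d (A n) + ?e n)"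
    by (intro suminf_le C(4)) auto
  also have "\<dots> = (\<Sum>n. hausdorff2_pre d (A n)) + (\<Sum>n. ?e n)"
    by (subst suminf_add) auto
  also have "(\<Sum>n. ?e n) = ennreal e"
    using sums_mult[OF power_half_series, of e] e
    by (intro suminf_ennreal_eq) auto
  finally show "hausdorff2_pre d (\<Union>n. A n) \<le> (\<Sum>n. hausdorff2_pre d (A n)) + ennreal e" .
qed

lemma hausdorff2_outer_UN:
  "hausdorff2_outer (\<Union>n. A n) \<le> (\<Sum>n. hausdorff2_outer (A n :: 'a::metric_space set))"
  unfolding hausdorff2_outer_def[of "\<Union>n. A n"]
proof (rule SUP_least)
  fix d :: real assume "d \<in> {0<..}"
  then have "(\<Sum>n. hausdorff2_pre d (A n)) \<le> (\<Sum>n. hausdorff2_outer (A n))"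
    by (intro suminf_le hausdorff2_pre_le_outer) auto
  with hausdorff2_pre_UN show "hausdorff2_pre d (\<Union>n. A n) \<le> (\<Sum>n. hausdorff2_outer (A n))"
    by (rule order_trans)
qed

lemma outer_measure_space_hausdorff2:
  "outer_measure_space UNIV (hausdorff2_outer :: 'a::metric_space set \<Rightarrow> ennreal)"
  by (auto simp: outer_measure_space_def positive_def increasing_def countably_subadditive_def
      hausdorff2_outer_mono hausdorff2_outer_UN)

lemma hausdorff2_outer_Un:
  "hausdorff2_outer (A \<union> B) \<le> hausdorff2_outer A + hausdorff2_outer (B :: 'a::metric_space set)"
proof -
  interpret sigma_algebra UNIV "UNIV :: 'a set set" using sigma_algebra_Pow[of "UNIV :: 'a set"] by simp
  have "subadditive UNIV (hausdorff2_outer :: 'a set \<Rightarrow> ennreal)"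
    using outer_measure_space_hausdorff2
    by (metis countably_subadditive_subadditive outer_measure_space_def)
  from subadditiveD[OF this, of A "B - A"] have
    "hausdorff2_outer (A \<union> B) \<le> hausdorff2_outer A + hausdorff2_outer (B - A)" by simp
  also have "\<dots> \<le> hausdorff2_outer A + hausdorff2_outer B"
    by (intro add_left_mono hausdorff2_outer_mono) auto
  finally show ?thesis .
qed

lemma hausdorff2_outer_separated:
  fixes A B :: "'a::metric_space set"
  assumes e: "0 < e" and sep: "\<And>x y. x \<in> A \<Longrightarrow> y \<in> B \<Longrightarrow> e \<le> dist x y"
  shows "hausdorff2_outer A + hausdorff2_outer B \<le> hausdorff2_outer (A \<union> B)"
proof -
  have pre: "hausdorff2_pre d A + hausdorff2_pre d B \<le> hausdorff2_pre d (A \<union> B)"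
    if d: "0 < d" "d < e" for d
    unfolding hausdorff2_pre_def[of d "A \<union> B"]
  proof (rule INF_greatest)
    fix C :: "nat \<Rightarrow> 'a set"
    assume C: "C \<in> {C. A \<union> B \<subseteq> (\<Union>i. C i) \<and> (\<forall>i. bounded (C i) \<and> diameter (C i) \<le> d)}"
    let ?r = "\<lambda>S i. if C i \<inter> S = {} then {} else C i"
    let ?s = "\<lambda>C. \<Sum>i. ennreal (pi / 4 * (diameter (C i :: 'a set))\<^sup>2)"
    have le: "hausdorff2_pre d S \<le> ?s (?r S)" if S: "S \<subseteq> A \<union> B" for S
      unfolding hausdorff2_pre_def
    proof (rule INF_lower, safe)
      fix x assume "x \<in> S"
      then obtain i where "x \<in> C i" using C S by blast
      then have "x \<in> ?r S i" using \<open>x \<in> S\<close> by auto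
      then show "x \<in> (\<Union>i. ?r S i)" by blast
    qed (use C d in auto)
    have excl: "C i \<inter> A = {} \<or> C i \<inter> B = {}" for i
    proof (rule ccontr)
      assume "\<not> ?thesis"
      then obtain x y where xy: "x \<in> C i" "x \<in> A" "y \<in> C i" "y \<in> B" by blast
      have "dist x y \<le> diameter (C i)" using C xy by (intro diameter_bounded_bound) auto
      moreover have "diameter (C i) \<le> d" using C by blast
      ultimately show False using sep[of x y] xy d by linarith
    qed
    have "hausdorff2_pre d A + hausdorff2_pre d B \<le> ?s (?r A) + ?s (?r B)"
      by (intro add_mono le) auto
    also have "\<dots> = (\<Sum>i. ennreal (pi / 4 * (diameter (?r A i))\<^sup>2) +
                            ennreal (pi / 4 * (diameter (?r B i))\<^sup>2))"
      by (rule suminf_add) auto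
    also have "\<dots> \<le> ?s C"
      by (rule suminf_le) (use excl in auto)
    finally show "hausdorff2_pre d A + hausdorff2_pre d B \<le> ?s C" .
  qed
  have inc: "incseq (\<lambda>n. hausdorff2_pre (1 / real (Suc n)) S)" for S :: "'a set"
    by (intro incseq_SucI hausdorff2_pre_antimono) (auto simp: divide_simps)
  have "hausdorff2_outer A + hausdorff2_outer B =
      (SUP n. hausdorff2_pre (1 / real (Suc n)) A + hausdorff2_pre (1 / real (Suc n)) B)"
    unfolding hausdorff2_outer_SUP_nat by (rule ennreal_SUP_add[symmetric]) (rule inc)+
  also have "\<dots> \<le> hausdorff2_outer (A \<union> B)"
  proof (rule SUP_least)
    fix n
    define d where "d = min (1 / real (Suc n)) (e / 2)"
    have d: "0 < d" "d < e" "d \<le> 1 / real (Suc n)" using e by (auto simp: d_def)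
    have "hausdorff2_pre (1 / real (Suc n)) A + hausdorff2_pre (1 / real (Suc n)) B
        \<le> hausdorff2_pre d A + hausdorff2_pre d B"
      using d by (intro add_mono hausdorff2_pre_antimono)
    also have "\<dots> \<le> hausdorff2_outer (A \<union> B)"
      using pre[of d] d hausdorff2_pre_le_outer[of d "A \<union> B"] by (meson order_trans)
    finally show "hausdorff2_pre (1 / real (Suc n)) A + hausdorff2_pre (1 / real (Suc n)) B
        \<le> hausdorff2_outer (A \<union> B)" .
  qed
  finally show ?thesis .
qed

lemma hausdorff2_outer_separated_sum:
  fixes R :: "nat \<Rightarrow> 'a::metric_space set"
  assumes e: "\<And>k. 0 < e k"
    and sep: "\<And>j k x y. j < k \<Longrightarrow> x \<in> R j \<Longrightarrow> y \<in> R k \<Longrightarrow> e k \<le> dist x y"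
  shows "(\<Sum>k. hausdorff2_outer (R k)) \<le> hausdorff2_outer (\<Union>k. R k)"
proof -
  have "(\<Sum>k<n. hausdorff2_outer (R k)) \<le> hausdorff2_outer (\<Union>k<n. R k)" for n
  proof (induction n)
    case (Suc n)
    have "(\<Sum>k<Suc n. hausdorff2_outer (R k)) \<le>
        hausdorff2_outer (\<Union>k<n. R k) + hausdorff2_outer (R n)"
      using Suc by (simp add: add_right_mono)
    also have "\<dots> \<le> hausdorff2_outer ((\<Union>k<n. R k) \<union> R n)"
      by (rule hausdorff2_outer_separated[of "e n"]) (use e sep in auto)
    also have "(\<Union>k<n. R k) \<union> R n = (\<Union>k<Suc n. R k)" by (auto simp: less_Suc_eq)
    finally show ?case .
  qed simp
  moreover have "hausdorff2_outer (\<Union>k<n. R k) \<le> hausdorff2_outer (\<Union>k. R k)" for n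
    by (intro hausdorff2_outer_mono) auto
  ultimately have "(\<Sum>k<n. hausdorff2_outer (R k)) \<le> hausdorff2_outer (\<Union>k. R k)" for n
    by (rule order_trans)
  then show ?thesis
    by (intro suminf_le_const summableI)
qed

lemma hausdorff2_outer_closed:
  fixes F A :: "'a::metric_space set"
  assumes F: "closed F"
  shows "hausdorff2_outer (A \<inter> F) + hausdorff2_outer (A - F) = hausdorff2_outer A"
proof (rule antisym)
  have "A = (A \<inter> F) \<union> (A - F)" by blast
  then show "hausdorff2_outer A \<le> hausdorff2_outer (A \<inter> F) + hausdorff2_outer (A - F)"
    using hausdorff2_outer_Un by metis
next
  show "hausdorff2_outer (A \<inter> F) + hausdorff2_outer (A - F) \<le> hausdorff2_outer A"
  proof (cases "F = {} \<or> hausdorff2_outer A = top")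
    case True
    then show ?thesis by auto
  next
    case False
    then have ne: "F \<noteq> {}" and fin: "hausdorff2_outer A < top" by (auto simp: less_top)
    define r where "r x = infdist x F" for x
    have r: "r x \<le> r y + dist x y" for x y
      unfolding r_def by (metis infdist_triangle)
    have r0: "r x = 0" if "x \<in> F" for x using that by (simp add: r_def)
    have rpos: "0 < r x" if "x \<notin> F" for x
      using that F ne infdist_nonneg[of x F] in_closed_iff_infdist_zero[OF F ne, of x]
      unfolding r_def by linarith
    define B where "B n = {x \<in> A. 1 / real (Suc n) \<le> r x}" for n
    define R where "R k = {x \<in> A. 1 / real (Suc (Suc k)) \<le> r x \<and> r x < 1 / real (Suc k)}" for k
    have alt: "(\<Sum>k. hausdorff2_outer (R (2 * k + p))) \<le> hausdorff2_outer A" for p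
    proof -
      let ?e = "\<lambda>k. 1 / real (2 * k + p) - 1 / real (Suc (2 * k + p))"
      let ?e' = "\<lambda>k. if 2 * k + p = 0 then 1 else ?e k"
      have "(\<Sum>k. hausdorff2_outer (R (2 * k + p))) \<le> hausdorff2_outer (\<Union>k. R (2 * k + p))"
      proof (rule hausdorff2_outer_separated_sum[of ?e'])
        show "0 < ?e' k" for k by (auto simp: field_simps)
        fix j k :: nat and x y :: 'a
        assume jk: "j < k" and x: "x \<in> R (2 * j + p)" and y: "y \<in> R (2 * k + p)"
        have "1 / real (2 * k + p) \<le> 1 / real (Suc (Suc (2 * j + p)))"
          using jk by (intro divide_left_mono) auto
        also have "\<dots> \<le> r x" using x by (auto simp: R_def)
        also have "\<dots> \<le> r y + dist x y" by (rule r)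
        also have "r y < 1 / real (Suc (2 * k + p))" using y by (auto simp: R_def)
        finally show "?e' k \<le> dist x y" using jk by auto
      qed
      also have "\<dots> \<le> hausdorff2_outer A"
        by (intro hausdorff2_outer_mono) (auto simp: R_def)
      finally show ?thesis .
    qed
    have sumR: "(\<Sum>k. hausdorff2_outer (R k)) < top"
    proof -
      have "(\<Sum>k<2 * n. hausdorff2_outer (R k)) \<le> hausdorff2_outer A + hausdorff2_outer A" for n
      proof -
        have "(\<Sum>k<2 * n. hausdorff2_outer (R k)) =
            (\<Sum>k<n. hausdorff2_outer (R (2 * k + 0))) + (\<Sum>k<n. hausdorff2_outer (R (2 * k + 1)))"
          by (induction n) (auto simp: algebra_simps)
        also have "\<dots> \<le> (\<Sum>k. hausdorff2_outer (R (2 * k + 0))) +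
            (\<Sum>k. hausdorff2_outer (R (2 * k + 1)))"
          by (intro add_mono sum_le_suminf) auto
        also have "\<dots> \<le> hausdorff2_outer A + hausdorff2_outer A"
          by (intro add_mono alt)
        finally show ?thesis .
      qed
      moreover have "(\<Sum>k<n. hausdorff2_outer (R k)) \<le> (\<Sum>k<2 * n. hausdorff2_outer (R k))" for n
        by (intro sum_mono2) auto
      ultimately have "(\<Sum>k. hausdorff2_outer (R k)) \<le> hausdorff2_outer A + hausdorff2_outer A"
        by (intro suminf_le_const summableI) (meson order_trans)
      also have "\<dots> < top" using fin by simp
      finally show ?thesis .
    qed
    have step: "hausdorff2_outer (A \<inter> F) + hausdorff2_outer (A - F) \<le>
        hausdorff2_outer A + (\<Sum>k. hausdorff2_outer (R (k + n)))" for n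
    proof -
      have "A - F \<subseteq> B n \<union> (\<Union>k. R (k + n))"
      proof
        fix x assume x: "x \<in> A - F"
        define P where "P m \<longleftrightarrow> 1 / real (Suc m) \<le> r x" for m
        obtain m0 where "P m0"
          using rpos[of x] x nat_approx_posE[of "r x"] unfolding P_def
          by (metis DiffD2 less_imp_le)
        define m where "m = (LEAST m. P m)"
        have Pm: "P m" unfolding m_def by (rule LeastI) fact
        show "x \<in> B n \<union> (\<Union>k. R (k + n))"
        proof (cases "m \<le> n")
          case True
          then have "1 / real (Suc n) \<le> 1 / real (Suc m)" by (intro divide_left_mono) auto
          then have "x \<in> B n" using Pm x by (auto simp: B_def P_def)
          then show ?thesis by blast
        next
          case False
          then obtain j where j: "m = Suc j" "n \<le> j" by (cases m) auto
          have "\<not> P j" using not_less_Least[of j P] j unfolding m_def by simp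
          then have "x \<in> R j" using Pm x j by (auto simp: R_def P_def)
          then have "x \<in> R ((j - n) + n)" using j by simp
          then show ?thesis by blast
        qed
      qed
      then have "hausdorff2_outer (A - F) \<le> hausdorff2_outer (B n \<union> (\<Union>k. R (k + n)))"
        by (rule hausdorff2_outer_mono)
      also have "\<dots> \<le> hausdorff2_outer (B n) + hausdorff2_outer (\<Union>k. R (k + n))"
        by (rule hausdorff2_outer_Un)
      also have "\<dots> \<le> hausdorff2_outer (B n) + (\<Sum>k. hausdorff2_outer (R (k + n)))"
        by (intro add_left_mono hausdorff2_outer_UN)
      finally have "hausdorff2_outer (A \<inter> F) + hausdorff2_outer (A - F) \<le>
          (hausdorff2_outer (A \<inter> F) + hausdorff2_outer (B n)) + (\<Sum>k. hausdorff2_outer (R (k + n)))"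
        by (simp add: add.assoc add_left_mono)
      also have "hausdorff2_outer (A \<inter> F) + hausdorff2_outer (B n) \<le> hausdorff2_outer (A \<inter> F \<union> B n)"
      proof (rule hausdorff2_outer_separated[of "1 / real (Suc n)"])
        fix x y assume "x \<in> A \<inter> F" "y \<in> B n"
        then show "1 / real (Suc n) \<le> dist x y"
          using r[of y x] r0[of x] by (auto simp: B_def dist_commute)
      qed simp
      also have "\<dots> \<le> hausdorff2_outer A"
        by (intro hausdorff2_outer_mono) (auto simp: B_def)
      finally show ?thesis by (simp add: add_right_mono)
    qed
    have "(\<lambda>n. \<Sum>k. hausdorff2_outer (R (k + n))) \<longlonglongrightarrow> 0"
    proof -
      define g where "g k = enn2real (hausdorff2_outer (R k))" for k
      have g: "hausdorff2_outer (R k) = ennreal (g k)" for k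
        unfolding g_def using sumR by (metis ennreal_enn2real ennreal_suminf_lessD)
      have g0: "0 \<le> g k" for k by (simp add: g_def)
      have sg: "summable g"
        using sumR g0 unfolding g by (intro summable_suminf_not_top) auto
      have "(\<Sum>k. hausdorff2_outer (R (k + n))) = ennreal (\<Sum>k. g (k + n))" for n
        unfolding g using g0 sg by (intro suminf_ennreal2 summable_ignore_initial_segment) auto
      moreover have "(\<lambda>n. \<Sum>k. g (k + n)) \<longlonglongrightarrow> 0"
        using suminf_exist_split2[OF sg] .
      ultimately show ?thesis
        using tendsto_ennrealI[of "\<lambda>n. \<Sum>k. g (k + n)" 0] by simp
    qed
    then have "(\<lambda>n. hausdorff2_outer A + (\<Sum>k. hausdorff2_outer (R (k + n)))) \<longlonglongrightarrow>
        hausdorff2_outer A + 0"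
      by (intro tendsto_add tendsto_const)
    then have "hausdorff2_outer (A \<inter> F) + hausdorff2_outer (A - F) \<le> hausdorff2_outer A + 0"
      by (rule LIMSEQ_le_const) (use step in blast)
    then show ?thesis by simp
  qed
qed

theorem emeasure_hausdorff2:
  fixes A :: "'a::metric_space set"
  assumes "A \<in> sets borel"
  shows "emeasure hausdorff2 A = hausdorff2_outer A"
proof -
  interpret S: sigma_algebra UNIV "UNIV :: 'a set set" using sigma_algebra_Pow[of "UNIV :: 'a set"] by simp
  let ?L = "lambda_system UNIV UNIV (hausdorff2_outer :: 'a set \<Rightarrow> ennreal)"
  have L: "measure_space UNIV ?L hausdorff2_outer"
    by (rule S.caratheodory_lemma[OF outer_measure_space_hausdorff2])
  have "{F :: 'a set. closed F} \<subseteq> ?L"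
    using hausdorff2_outer_closed by (auto simp: S.lambda_system_eq)
  then have sub: "sets borel \<subseteq> ?L"
    using L unfolding borel_eq_closed
    by (simp add: measure_space_def sigma_algebra.sigma_sets_subset)
  have "measure_space UNIV (sets borel) (hausdorff2_outer :: 'a set \<Rightarrow> ennreal)"
    using measure_space_def L sub
    by (auto simp: measure_space_def positive_def countably_additive_def
        intro: sets.sigma_algebra_axioms[of borel, simplified])
  then show ?thesis
    using assms unfolding hausdorff2_def
    by (subst emeasure_measure_of_sigma) (auto simp: measure_space_def)
qed


section \<open>Surfaces and tangential calculus\<close>

text \<open>Gradient with respect to a filter: \<open>at x\<close> for the full gradient, \<open>at x within T\<close> for the
  one-sided gradient of a piecewise smooth function on a tetrahedron \<open>T\<close>.\<close>

definition grad :: "(real^3 \<Rightarrow> real) \<Rightarrow> (real^3) filter \<Rightarrow> real^3" where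
  "grad f F = (\<chi> i. frechet_derivative f F (axis i 1))"

definition C1_on :: "(real^3) set \<Rightarrow> (real^3 \<Rightarrow> 'b::real_normed_vector) \<Rightarrow> bool" where
  "C1_on U f \<longleftrightarrow> (\<exists>f' :: real^3 \<Rightarrow> ((real^3) \<Rightarrow>\<^sub>L 'b).
     (\<forall>x\<in>U. (f has_derivative blinfun_apply (f' x)) (at x)) \<and> continuous_on U f')"

definition C2_on :: "(real^3) set \<Rightarrow> (real^3 \<Rightarrow> 'b::real_normed_vector) \<Rightarrow> bool" where
  "C2_on U f \<longleftrightarrow> (\<exists>f' :: real^3 \<Rightarrow> ((real^3) \<Rightarrow>\<^sub>L 'b).
     (\<forall>x\<in>U. (f has_derivative blinfun_apply (f' x)) (at x)) \<and> C1_on U f')"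

definition local_defining_function ::
  "(real^3) set \<Rightarrow> real^3 \<Rightarrow> (real^3) set \<Rightarrow> (real^3 \<Rightarrow> real) \<Rightarrow> bool" where
  "local_defining_function \<Gamma> x U \<psi> \<longleftrightarrow>
     open U \<and> x \<in> U \<and> C2_on U \<psi> \<and> (\<forall>y\<in>U. grad \<psi> (at y) \<noteq> 0) \<and> \<Gamma> \<inter> U = {y \<in> U. \<psi> y = 0}"

text \<open>Closed surface: compact without boundary. The regularity \<open>C\<^sup>2\<close> is what makes the closest point
  projection well defined near the surface. The surface is not given through the global level set
  function, which may be merely Lipschitz.\<close>

definition closed_C2_surface :: "(real^3) set \<Rightarrow> bool" where
  "closed_C2_surface \<Gamma> \<longleftrightarrow> compact \<Gamma> \<and> (\<forall>x\<in>\<Gamma>. \<exists>U \<psi>. local_defining_function \<Gamma> x U \<psi>)"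

text \<open>\<open>I - \<nu> \<nu>\<^sup>T\<close>\<close>

definition proj_matrix :: "real^3 \<Rightarrow> real^3^3" where
  "proj_matrix \<nu> = mat 1 - (columnvector \<nu> :: real^1^3) ** (rowvector \<nu> :: real^3^1)"

text \<open>The sign of the unit normal is chosen arbitrarily at each point; the normal is used only in
  expressions that do not depend on this sign.\<close>

definition unit_normal :: "(real^3) set \<Rightarrow> real^3 \<Rightarrow> real^3" where
  "unit_normal \<Gamma> x = (SOME \<nu>. \<exists>U \<psi>. local_defining_function \<Gamma> x U \<psi> \<and>
     \<nu> = grad \<psi> (at x) /\<^sub>R norm (grad \<psi> (at x)))"

definition tangential :: "(real^3) set \<Rightarrow> (real^3 \<Rightarrow> real^3) \<Rightarrow> bool" where
  "tangential \<Gamma> \<Psi> \<longleftrightarrow> (\<forall>x\<in>\<Gamma>. \<Psi> x \<bullet> unit_normal \<Gamma> x = 0)"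

definition surface_div :: "(real^3) set \<Rightarrow> (real^3 \<Rightarrow> real^3) \<Rightarrow> real^3 \<Rightarrow> real" where
  "surface_div \<Gamma> \<Psi> x = trace (proj_matrix (unit_normal \<Gamma> x) ** jacobian \<Psi> (at x))"

definition surface_L2 :: "(real^3) set \<Rightarrow> (real^3 \<Rightarrow> 'b::euclidean_space) \<Rightarrow> bool" where
  "surface_L2 \<Gamma> v \<longleftrightarrow> set_borel_measurable hausdorff2 \<Gamma> v \<and>
     set_integrable hausdorff2 \<Gamma> (\<lambda>x. (norm (v x))\<^sup>2)"

text \<open>Weak surface gradient. Testing with tangential fields avoids the mean curvature term in the
  integration by parts formula.\<close>

definition has_weak_surface_grad ::
  "(real^3) set \<Rightarrow> (real^3 \<Rightarrow> real) \<Rightarrow> (real^3 \<Rightarrow> real^3) \<Rightarrow> bool" where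
  "has_weak_surface_grad \<Gamma> v g \<longleftrightarrow> surface_L2 \<Gamma> g \<and> tangential \<Gamma> g \<and>
     (\<forall>\<Psi>. C1_on UNIV \<Psi> \<and> tangential \<Gamma> \<Psi> \<longrightarrow>
       (LINT x:\<Gamma>|hausdorff2. g x \<bullet> \<Psi> x) = - (LINT x:\<Gamma>|hausdorff2. v x * surface_div \<Gamma> \<Psi> x))"

definition in_H1 :: "(real^3) set \<Rightarrow> (real^3 \<Rightarrow> real) \<Rightarrow> bool" where
  "in_H1 \<Gamma> v \<longleftrightarrow> surface_L2 \<Gamma> v \<and> (\<exists>g. has_weak_surface_grad \<Gamma> v g)"

text \<open>A representative of the weak gradient, which is unique almost everywhere.\<close>

definition surface_grad :: "(real^3) set \<Rightarrow> (real^3 \<Rightarrow> real) \<Rightarrow> real^3 \<Rightarrow> real^3" where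
  "surface_grad \<Gamma> v = (SOME g. has_weak_surface_grad \<Gamma> v g)"


section \<open>Meshes and piecewise polynomials\<close>

definition tetrahedral_mesh :: "(real^3) set \<Rightarrow> (real^3) set set \<Rightarrow> bool" where
  "tetrahedral_mesh \<Omega> \<T> \<longleftrightarrow> triangulation \<T> \<and> (\<forall>T\<in>\<T>. 3 simplex T) \<and> \<Union>\<T> = closure \<Omega>"

definition mesh_size :: "(real^3) set set \<Rightarrow> real" where
  "mesh_size \<T> = Max (diameter ` \<T>)"

definition inradius :: "(real^3) set \<Rightarrow> real" where
  "inradius T = Sup {r. 0 \<le> r \<and> (\<exists>x. cball x r \<subseteq> T)}"

text \<open>For a family of meshes, the constants \<open>\<sigma>\<close> and \<open>\<kappa>\<close> are independent of the mesh size.\<close>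

definition shape_regular :: "real \<Rightarrow> (real^3) set set \<Rightarrow> bool" where
  "shape_regular \<sigma> \<T> \<longleftrightarrow> (\<forall>T\<in>\<T>. diameter T \<le> \<sigma> * inradius T)"

definition quasi_uniform :: "real \<Rightarrow> (real^3) set set \<Rightarrow> bool" where
  "quasi_uniform \<kappa> \<T> \<longleftrightarrow> (\<forall>T\<in>\<T>. mesh_size \<T> \<le> \<kappa> * diameter T)"

text \<open>Polynomial functions of total degree at most \<open>k\<close> in three variables, with multi-indices
  \<open>\<alpha>\<close>.\<close>

definition polys :: "nat \<Rightarrow> (real^3 \<Rightarrow> real) set" where
  "polys k = {p. \<exists>a :: (3 \<Rightarrow> nat) \<Rightarrow> real.
     p = (\<lambda>x. \<Sum>\<alpha> | (\<Sum>i\<in>UNIV. \<alpha> i) \<le> k. a \<alpha> * (\<Prod>i\<in>UNIV. x $ i ^ \<alpha> i))}"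

definition fe_space :: "(real^3) set set \<Rightarrow> nat \<Rightarrow> (real^3 \<Rightarrow> real) set" where
  "fe_space \<S> k = {w. continuous_on (\<Union>\<S>) w \<and> (\<forall>T\<in>\<S>. \<exists>p\<in>polys k. \<forall>x\<in>T. w x = p x)}"

text \<open>Principal lattice of order \<open>q\<close>: the points of \<open>T\<close> whose barycentric coordinates are integer
  multiples of \<open>1/q\<close>.\<close>

definition lagrange_nodes :: "nat \<Rightarrow> (real^3) set \<Rightarrow> (real^3) set" where
  "lagrange_nodes q T =
     {(\<Sum>v | v extreme_point_of T. (real (k v) / real q) *\<^sub>R v) | k :: real^3 \<Rightarrow> nat.
        (\<Sum>v | v extreme_point_of T. k v) = q}"

definition is_lagrange_interpolant ::
  "(real^3) set set \<Rightarrow> nat \<Rightarrow> (real^3 \<Rightarrow> real) \<Rightarrow> (real^3 \<Rightarrow> real) \<Rightarrow> bool" where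
  "is_lagrange_interpolant \<T> q \<phi> \<phi>h \<longleftrightarrow>
     \<phi>h \<in> fe_space \<T> q \<and> (\<forall>T\<in>\<T>. \<forall>x\<in>lagrange_nodes q T. \<phi>h x = \<phi> x)"


section \<open>Discrete surface and bilinear forms\<close>

definition discrete_surface :: "(real^3) set set \<Rightarrow> (real^3 \<Rightarrow> real) \<Rightarrow> (real^3) set" where
  "discrete_surface \<T> \<phi>h = {x \<in> \<Union>\<T>. \<phi>h x = 0}"

definition cut_mesh :: "(real^3) set set \<Rightarrow> (real^3 \<Rightarrow> real) \<Rightarrow> (real^3) set set" where
  "cut_mesh \<T> \<phi>h = {T \<in> \<T>. T \<inter> discrete_surface \<T> \<phi>h \<noteq> {}}"

definition cut_domain :: "(real^3) set set \<Rightarrow> (real^3 \<Rightarrow> real) \<Rightarrow> (real^3) set" where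
  "cut_domain \<T> \<phi>h = \<Union>(cut_mesh \<T> \<phi>h)"

abbreviation Vh :: "(real^3) set set \<Rightarrow> (real^3 \<Rightarrow> real) \<Rightarrow> nat \<Rightarrow> (real^3 \<Rightarrow> real) set" where
  "Vh \<T> \<phi>h m \<equiv> fe_space (cut_mesh \<T> \<phi>h) m"

text \<open>Elementwise gradient on the cut mesh. At a point shared by several tetrahedra one of them is
  selected. The bulk integrals do not see this choice. Nor do the surface integrals below: they
  involve only projected gradients, and where \<open>\<Gamma>\<^sub>h\<close> contains a part of a face with positive surface
  measure it contains the whole face, so that \<open>P\<^sub>h\<close> projects onto the plane of that face and
  continuous functions have the same tangential gradient from both sides.\<close>

definition pw_grad :: "(real^3) set set \<Rightarrow> (real^3 \<Rightarrow> real) \<Rightarrow> (real^3 \<Rightarrow> real) \<Rightarrow> real^3 \<Rightarrow> real^3" where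
  "pw_grad \<T> \<phi>h w x = grad w (at x within (SOME T. T \<in> cut_mesh \<T> \<phi>h \<and> x \<in> T))"

definition discrete_normal :: "(real^3) set set \<Rightarrow> (real^3 \<Rightarrow> real) \<Rightarrow> real^3 \<Rightarrow> real^3" where
  "discrete_normal \<T> \<phi>h x = pw_grad \<T> \<phi>h \<phi>h x /\<^sub>R norm (pw_grad \<T> \<phi>h \<phi>h x)"

definition discrete_surface_grad ::
  "(real^3) set set \<Rightarrow> (real^3 \<Rightarrow> real) \<Rightarrow> (real^3 \<Rightarrow> real) \<Rightarrow> real^3 \<Rightarrow> real^3" where
  "discrete_surface_grad \<T> \<phi>h w x = proj_matrix (discrete_normal \<T> \<phi>h x) *v pw_grad \<T> \<phi>h w x"

text \<open>Without this nondegeneracy condition (satisfied for small mesh size) \<open>\<Gamma>\<^sub>h\<close> need not be a surface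
  and \<open>n\<^sub>h = \<nabla>\<phi>\<^sub>h/|\<nabla>\<phi>\<^sub>h|\<close> is not defined. It is imposed only at points of \<open>\<Gamma>\<^sub>h\<close>, with respect to
  every tetrahedron containing the point; then \<open>\<nabla>\<phi>\<^sub>h\<close>, a nonzero polynomial on each cut tetrahedron,
  is nonzero almost everywhere in \<open>\<Omega>\<^sub>h\<^sup>\<Gamma>\<close>.\<close>

definition nondegenerate :: "(real^3) set set \<Rightarrow> (real^3 \<Rightarrow> real) \<Rightarrow> bool" where
  "nondegenerate \<T> \<phi>h \<longleftrightarrow>
     (\<forall>T\<in>cut_mesh \<T> \<phi>h. \<forall>x\<in>T \<inter> discrete_surface \<T> \<phi>h. grad \<phi>h (at x within T) \<noteq> 0)"

definition ip_h ::
  "(real^3) set set \<Rightarrow> (real^3 \<Rightarrow> real) \<Rightarrow> (real^3 \<Rightarrow> real) \<Rightarrow> (real^3 \<Rightarrow> real) \<Rightarrow> real" where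
  "ip_h \<T> \<phi>h u v = (LINT x:discrete_surface \<T> \<phi>h|hausdorff2. u x * v x)"

definition a_h ::
  "(real^3) set set \<Rightarrow> (real^3 \<Rightarrow> real) \<Rightarrow> (real^3 \<Rightarrow> real) \<Rightarrow> (real^3 \<Rightarrow> real) \<Rightarrow> real" where
  "a_h \<T> \<phi>h u v =
     (LINT x:discrete_surface \<T> \<phi>h|hausdorff2.
        discrete_surface_grad \<T> \<phi>h u x \<bullet> discrete_surface_grad \<T> \<phi>h v x) +
     mesh_size \<T> * (LINT x:cut_domain \<T> \<phi>h|lborel.
        (discrete_normal \<T> \<phi>h x \<bullet> pw_grad \<T> \<phi>h u x) *
        (discrete_normal \<T> \<phi>h x \<bullet> pw_grad \<T> \<phi>h v x))"


section \<open>Stabilized Ritz projection\<close>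

text \<open>\<open>w\<^sup>\<ell>(p(x)) = w(x)\<close> for \<open>x \<in> \<Gamma>\<^sub>h\<close>, with \<open>p\<close> the closest point projection onto \<open>\<Gamma>\<close> (a bijection
  from \<open>\<Gamma>\<^sub>h\<close> onto \<open>\<Gamma>\<close> for small mesh size).\<close>

definition surface_lift ::
  "(real^3) set \<Rightarrow> (real^3) set set \<Rightarrow> (real^3 \<Rightarrow> real) \<Rightarrow> (real^3 \<Rightarrow> real) \<Rightarrow> real^3 \<Rightarrow> real" where
  "surface_lift \<Gamma> \<T> \<phi>h w y = w (inv_into (discrete_surface \<T> \<phi>h) (closest_point \<Gamma>) y)"

definition is_ritz_projection ::
  "(real^3) set \<Rightarrow> (real^3) set set \<Rightarrow> (real^3 \<Rightarrow> real) \<Rightarrow> nat \<Rightarrow>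
     (real^3 \<Rightarrow> real) \<Rightarrow> (real^3 \<Rightarrow> real) \<Rightarrow> bool" where
  "is_ritz_projection \<Gamma> \<T> \<phi>h m v u \<longleftrightarrow>
     u \<in> Vh \<T> \<phi>h m \<and>
     (\<forall>w\<in>Vh \<T> \<phi>h m. a_h \<T> \<phi>h u w =
        (LINT x:\<Gamma>|hausdorff2. surface_grad \<Gamma> v x \<bullet> surface_grad \<Gamma> (surface_lift \<Gamma> \<T> \<phi>h w) x)) \<and>
     ip_h \<T> \<phi>h (\<lambda>x. u x - v (closest_point \<Gamma> x)) (\<lambda>_. 1) = 0"


section \<open>Potential and energy\<close>

definition f0 :: "real \<Rightarrow> real \<Rightarrow> real" where
  "f0 K c =
     (if c > K then 1/2 * (3 * K\<^sup>2 - 1) * c\<^sup>2 - 2 * K^3 * c + 1/4 * (3 * K^4 + 1)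
      else if c < - K then 1/2 * (3 * K\<^sup>2 - 1) * c\<^sup>2 + 2 * K^3 * c + 1/4 * (3 * K^4 + 1)
      else 1/4 * (c\<^sup>2 - 1)\<^sup>2)"

definition energy_h ::
  "(real^3) set set \<Rightarrow> (real^3 \<Rightarrow> real) \<Rightarrow> real \<Rightarrow> real \<Rightarrow> (real^3 \<Rightarrow> real) \<Rightarrow> real" where
  "energy_h \<T> \<phi>h \<epsilon> K c =
     \<epsilon>\<^sup>2 / 2 * a_h \<T> \<phi>h c c + (LINT x:discrete_surface \<T> \<phi>h|hausdorff2. f0 K (c x))"

end

theory Submission
  imports Defs
begin

text \<open>The dissipation law is the discrete counterpart of testing the Cahn--Hilliard system with \<open>\<mu>\<close>
  and \<open>\<partial>\<^sub>t c\<close>. Test the first equation of the scheme with \<open>\<mu>\<^sub>h\<^sup>n\<^sup>+\<^sup>1\<close> and the second one with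
  \<open>\<delta>c = c\<^sub>h\<^sup>n\<^sup>+\<^sup>1 - c\<^sub>h\<^sup>n\<close>; the common term \<open>(\<mu>\<^sub>h\<^sup>n\<^sup>+\<^sup>1, \<delta>c)\<close> drops out and

    \<open>- M \<tau> a\<^sub>h(\<mu>, \<mu>) = \<beta>\<^sub>s (\<delta>c, \<delta>c) + (f\<^sub>0'(c\<^sup>n), \<delta>c) + \<epsilon>\<^sup>2 a\<^sub>h(c\<^sup>n\<^sup>+\<^sup>1, \<delta>c)\<close>.

  Polarization of the symmetric form turns \<open>a\<^sub>h(c\<^sup>n\<^sup>+\<^sup>1, \<delta>c)\<close> into half the increment of
  \<open>a\<^sub>h(c, c)\<close> plus half of \<open>a\<^sub>h(\<delta>c, \<delta>c)\<close> (lemma \<open>a_h_polarization\<close>). As \<open>L t\<^sup>2/2 - f\<^sub>0(t)\<close> is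
  convex, \<open>f\<^sub>0(c\<^sup>n\<^sup>+\<^sup>1) - f\<^sub>0(c\<^sup>n)\<close> is at most \<open>f\<^sub>0'(c\<^sup>n) \<delta>c + L/2 (\<delta>c)\<^sup>2\<close> pointwise (lemma
  \<open>f0_Taylor_upper_bound\<close>), and \<open>\<beta>\<^sub>s \<ge> L/2\<close> absorbs the last term.

  This computation presupposes that the surface integrals are additive and monotone, that is, that all
  integrands are integrable. So the area of \<open>\<Gamma>\<^sub>h\<close> has to be finite (lemma
  \<open>emeasure_discrete_surface_finite\<close>): near each of its points, \<open>\<Gamma>\<^sub>h\<close> is within each
  tetrahedron a regular zero set of a polynomial, where two of the coordinates control the third, and
  a covering by preimages of small squares bounds its Hausdorff measure; compactness does the rest.
  And the elementwise gradients, which are defined through an arbitrary choice of a tetrahedron at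
  points of common faces, have to be bounded, measurable, and linear in the function (lemmas
  \<open>bounded_measurable_pw_grad\<close> and \<open>pw_grad_diff\<close>).\<close>

section \<open>Finite Hausdorff measure of regular level sets\<close>

text \<open>If two real coordinates control the distance in \<open>S\<close>, then \<open>S\<close> is at most as large as a planar
  square: cut the square of coordinates into squares of side \<open>1/N\<close>. Their preimages have diameter
  at most \<open>2C/N\<close>, and their number is of order \<open>N\<^sup>2\<close>, so that the sum of the squared diameters is
  bounded independently of \<open>N\<close>.\<close>

lemma hausdorff2_outer_finite_if_planar_coordinates:
  fixes S :: "'a::metric_space set" and a b :: "'a \<Rightarrow> real"
  assumes bd: "\<And>x. x \<in> S \<Longrightarrow> \<bar>a x\<bar> \<le> R" "\<And>x. x \<in> S \<Longrightarrow> \<bar>b x\<bar> \<le> R"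
    and C: "0 \<le> C"
    and lip: "\<And>x y. x \<in> S \<Longrightarrow> y \<in> S \<Longrightarrow> dist x y \<le> C * (\<bar>a x - a y\<bar> + \<bar>b x - b y\<bar>)"
  shows "hausdorff2_outer S < top"
proof -
  obtain r :: nat where r: "R < real r" using reals_Archimedean2 by blast
  let ?B = "pi / 4 * (4 * real r * C)\<^sup>2"
  have "hausdorff2_pre d S \<le> ennreal ?B" if d: "0 < d" for d
  proof -
    obtain N :: nat where "2 * C / d < real N" using reals_Archimedean2 by blast
    moreover have "0 \<le> 2 * C / d" using d C by simp
    ultimately have N0: "0 < real N" by linarith
    have N: "0 < N" "2 * C / real N \<le> d"
      using N0 d \<open>2 * C / d < real N\<close> by (simp_all add: field_simps)
    \<comment> \<open>The coordinates lie in an interval of length \<open>2r\<close>, which is cut into \<open>m\<close> pieces of length \<open>1/N\<close>.\<close>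
    define m where "m = 2 * r * N"
    define idx where "idx t = nat \<lfloor>(t + real r) * real N\<rfloor>" for t :: real
    have idx_less: "idx t < m" if "\<bar>t\<bar> < real r" for t
    proof -
      have "(t + real r) * real N < (real r + real r) * real N"
        using that N by (intro mult_strict_right_mono) auto
      also have "\<dots> = real m" by (simp add: m_def)
      finally have "\<lfloor>(t + real r) * real N\<rfloor> < int m" by linarith
      moreover have "0 \<le> (t + real r) * real N" using that by auto
      ultimately show ?thesis unfolding idx_def by linarith
    qed
    have idx_close: "\<bar>s - t\<bar> \<le> 1 / real N"
      if "\<bar>s\<bar> < real r" "\<bar>t\<bar> < real r" "idx s = idx t" for s t
    proof -
      have "0 \<le> (t + real r) * real N" "0 \<le> (s + real r) * real N" using that by auto
      with that(3) have "\<bar>(s + real r) * real N - (t + real r) * real N\<bar> \<le> 1"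
        unfolding idx_def by linarith
      also have "(s + real r) * real N - (t + real r) * real N = (s - t) * real N"
        by (simp add: algebra_simps)
      finally have "\<bar>s - t\<bar> * real N \<le> 1" by (simp add: abs_mult)
      then show ?thesis using N(1) by (simp add: pos_le_divide_eq)
    qed
    \<comment> \<open>The \<open>m\<^sup>2\<close> cells are enumerated by \<open>n = p m + q\<close>; the countable cover is filled up with empty sets.\<close>
    define cell where
      "cell n = (if n < m * m then {x \<in> S. idx (a x) = n div m \<and> idx (b x) = n mod m} else {})" for n
    have ar: "\<bar>a x\<bar> < real r" "\<bar>b x\<bar> < real r" if "x \<in> S" for x
      using bd(1)[OF that] bd(2)[OF that] r by auto
    have close: "dist x y \<le> 2 * C / real N" if "x \<in> cell n" "y \<in> cell n" for x y n
    proof -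
      have xy: "x \<in> S" "y \<in> S" "idx (a x) = idx (a y)" "idx (b x) = idx (b y)"
        using that by (auto simp: cell_def split: if_splits)
      have "dist x y \<le> C * (\<bar>a x - a y\<bar> + \<bar>b x - b y\<bar>)" by (rule lip) fact+
      also have "\<dots> \<le> C * (1 / real N + 1 / real N)"
        using xy ar by (intro mult_left_mono add_mono idx_close C) auto
      finally show ?thesis by (simp add: mult.commute)
    qed
    have diam: "diameter (cell n) \<le> 2 * C / real N" for n
      unfolding diameter_def using close C by (auto intro!: cSUP_least)
    have cellbd: "bounded (cell n)" for n
      using close bounded_def by metis
    have cover: "S \<subseteq> (\<Union>n. cell n)"
    proof
      fix x assume x: "x \<in> S"
      let ?n = "idx (a x) * m + idx (b x)"
      have lt: "idx (a x) < m" "idx (b x) < m" using ar[OF x] idx_less by auto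
      then have "Suc (idx (a x)) * m \<le> m * m" by (intro mult_right_mono) auto
      then have "?n < m * m" using lt by simp
      then have "x \<in> cell ?n" using lt x by (simp add: cell_def)
      then show "x \<in> (\<Union>n. cell n)" by blast
    qed
    have "hausdorff2_pre d S \<le> (\<Sum>n. ennreal (pi / 4 * (diameter (cell n))\<^sup>2))"
      unfolding hausdorff2_pre_def
      by (rule INF_lower) (use cover cellbd diam N in \<open>auto intro: order_trans\<close>)
    also have "\<dots> = (\<Sum>n<m * m. ennreal (pi / 4 * (diameter (cell n))\<^sup>2))"
      by (rule suminf_finite) (auto simp: cell_def)
    also have "\<dots> \<le> (\<Sum>n<m * m. ennreal (pi / 4 * (2 * C / real N)\<^sup>2))"
      using diam cellbd by (intro sum_mono ennreal_leI mult_left_mono power_mono diameter_ge_0) auto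
    also have "\<dots> = ennreal (real (m * m) * (pi / 4 * (2 * C / real N)\<^sup>2))"
      by (simp only: sum_constant card_lessThan ennreal_of_nat_eq_real_of_nat)
         (rule ennreal_mult[symmetric], auto)
    also have "real (m * m) * (pi / 4 * (2 * C / real N)\<^sup>2) = ?B"
      using N by (simp add: m_def field_simps power2_eq_square)
    finally show ?thesis .
  qed
  then have "hausdorff2_outer S \<le> ennreal ?B"
    unfolding hausdorff2_outer_def by (intro SUP_least) auto
  also have "\<dots> < top" by simp
  finally show ?thesis .
qed

text \<open>A quantitative substitute for the implicit function theorem. Near \<open>x\<close> one partial derivative, say
  the \<open>i\<close>-th, stays away from zero. The mean value theorem between two zeros \<open>y\<close> and \<open>z\<close> gives a
  gradient orthogonal to \<open>z - y\<close>, and hence the \<open>i\<close>-th coordinate of \<open>z - y\<close> is controlled by the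
  two others.\<close>

lemma hausdorff2_outer_regular_zero_set_locally_finite:
  fixes p :: "real^3 \<Rightarrow> real" and G :: "real^3 \<Rightarrow> real^3"
  assumes der: "\<And>y. (p has_derivative (\<lambda>h. G y \<bullet> h)) (at y)"
    and cont: "continuous_on UNIV G" and nz: "G x \<noteq> 0"
  shows "\<exists>r>0. hausdorff2_outer (ball x r \<inter> {y. p y = 0}) < top"
proof -
  obtain i where i: "G x $ i \<noteq> 0" using nz by (auto simp: vec_eq_iff)
  obtain j k :: 3 where ijk: "UNIV = {i, j, k}" "i \<noteq> j" "i \<noteq> k" "j \<noteq> k"
  proof -
    have "card (UNIV - {i}) = 2" by (simp add: card_Diff_singleton)
    then obtain j k where "UNIV - {i} = {j, k}" "j \<noteq> k" by (metis card_2_iff)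
    then show ?thesis using that[of j k] by blast
  qed
  have sum3: "(\<Sum>l\<in>UNIV. f l) = f i + (f j + f k)" for f :: "3 \<Rightarrow> real"
    unfolding ijk(1) using ijk(2-4) by simp
  define e where "e = \<bar>G x $ i\<bar> / 2"
  have e: "0 < e" using i by (simp add: e_def)
  obtain r where r: "0 < r" "\<And>y. dist y x < r \<Longrightarrow> dist (G y) (G x) < e"
    using cont e unfolding continuous_on_iff by (metis UNIV_I)
  define b where "b = norm (G x) + e"
  have Gi: "e \<le> \<bar>G y $ i\<bar>" and Gb: "\<And>l. \<bar>G y $ l\<bar> \<le> b" if "y \<in> ball x r" for y
  proof -
    have d: "norm (G y - G x) < e" using r(2)[of y] that by (simp add: dist_norm norm_minus_commute)
    have "\<bar>(G y - G x) $ i\<bar> \<le> norm (G y - G x)" by (rule component_le_norm_cart)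
    then show "e \<le> \<bar>G y $ i\<bar>" using d unfolding e_def by (simp add: field_simps)
    have "norm (G y) \<le> b" using d norm_triangle_ineq2[of "G y" "G x"] by (simp add: b_def)
    then show "\<bar>G y $ l\<bar> \<le> b" for l using component_le_norm_cart[of "G y" l] by linarith
  qed
  let ?S = "ball x r \<inter> {y. p y = 0}"
  have b: "0 \<le> b" using e by (simp add: b_def)
  have "hausdorff2_outer ?S < top"
  proof (rule hausdorff2_outer_finite_if_planar_coordinates)
    show "\<bar>y $ j\<bar> \<le> norm x + r" "\<bar>y $ k\<bar> \<le> norm x + r" if "y \<in> ?S" for y
    proof -
      have "norm y \<le> norm x + r"
        using that norm_triangle_ineq2[of y x] by (simp add: dist_norm norm_minus_commute)
      then show "\<bar>y $ j\<bar> \<le> norm x + r" "\<bar>y $ k\<bar> \<le> norm x + r"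
        using component_le_norm_cart[of y j] component_le_norm_cart[of y k] by linarith+
    qed
    show "0 \<le> 1 + b / e" using b e by simp
    fix y z assume y: "y \<in> ?S" and z: "z \<in> ?S"
    define w where "w = z - y"
    have "((\<lambda>t. p (y + t *\<^sub>R w)) has_derivative (\<lambda>s. G (y + t *\<^sub>R w) \<bullet> (s *\<^sub>R w))) (at t)" for t
      by (rule has_derivative_compose[OF _ der]) (auto intro!: derivative_eq_intros)
    then have der: "((\<lambda>t. p (y + t *\<^sub>R w)) has_derivative (\<lambda>s. G (y + t *\<^sub>R w) \<bullet> (s *\<^sub>R w)))
        (at t within {0..1})" for t
      by (rule has_derivative_at_withinI)
    obtain t where t: "t \<in> {0<..<1}"
        "p (y + 1 *\<^sub>R w) - p (y + 0 *\<^sub>R w) = G (y + t *\<^sub>R w) \<bullet> ((1 - 0) *\<^sub>R w)"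
      using mvt_simple[OF zero_less_one der] by blast
    define g where "g = G (y + t *\<^sub>R w)"
    have "y + t *\<^sub>R w = (1 - t) *\<^sub>R y + t *\<^sub>R z" by (simp add: w_def algebra_simps)
    then have "y + t *\<^sub>R w \<in> closed_segment y z"
      using t(1) unfolding in_segment by (intro exI[of _ t]) auto
    then have tb: "y + t *\<^sub>R w \<in> ball x r"
      using y z closed_segment_subset[of y "ball x r" z] by auto
    have "g \<bullet> w = 0" using t(2) y z by (simp add: g_def w_def)
    then have "g $ i * w $ i + (g $ j * w $ j + g $ k * w $ k) = 0"
      by (simp add: inner_vec_def sum3)
    then have "\<bar>g $ i\<bar> * \<bar>w $ i\<bar> = \<bar>g $ j * w $ j + g $ k * w $ k\<bar>"
      by (metis abs_minus_cancel abs_mult add_eq_0_iff)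
    also have "\<dots> \<le> \<bar>g $ j\<bar> * \<bar>w $ j\<bar> + \<bar>g $ k\<bar> * \<bar>w $ k\<bar>"
      by (metis abs_mult abs_triangle_ineq)
    also have "\<dots> \<le> b * \<bar>w $ j\<bar> + b * \<bar>w $ k\<bar>"
      unfolding g_def using Gb[OF tb] by (intro add_mono mult_right_mono) auto
    finally have "\<bar>g $ i\<bar> * \<bar>w $ i\<bar> \<le> b * \<bar>w $ j\<bar> + b * \<bar>w $ k\<bar>" .
    moreover have "e * \<bar>w $ i\<bar> \<le> \<bar>g $ i\<bar> * \<bar>w $ i\<bar>"
      unfolding g_def using Gi[OF tb] by (intro mult_right_mono) auto
    ultimately have wi: "\<bar>w $ i\<bar> \<le> b / e * (\<bar>w $ j\<bar> + \<bar>w $ k\<bar>)"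
      using e by (simp add: field_simps)
    have "dist y z = norm w" by (simp add: w_def dist_norm norm_minus_commute)
    also have "\<dots> \<le> \<bar>w $ i\<bar> + (\<bar>w $ j\<bar> + \<bar>w $ k\<bar>)"
      using norm_le_l1_cart[of w] unfolding sum3 .
    also have "\<dots> \<le> (1 + b / e) * (\<bar>w $ j\<bar> + \<bar>w $ k\<bar>)"
      using wi by (simp add: algebra_simps)
    finally show "dist y z \<le> (1 + b / e) * (\<bar>y $ j - z $ j\<bar> + \<bar>y $ k - z $ k\<bar>)"
      by (simp add: w_def abs_minus_commute)
  qed
  then show ?thesis using r by blast
qed

lemma hausdorff2_outer_finite_UN:
  fixes A :: "'i \<Rightarrow> 'a::metric_space set"
  assumes "finite F" "\<And>i. i \<in> F \<Longrightarrow> hausdorff2_outer (A i) < top"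
  shows "hausdorff2_outer (\<Union>i\<in>F. A i) < top"
  using assms
proof (induction F)
  case (insert i F)
  have "hausdorff2_outer (\<Union>j\<in>insert i F. A j) \<le> hausdorff2_outer (A i) + hausdorff2_outer (\<Union>j\<in>F. A j)"
    using hausdorff2_outer_Un by simp
  also have "\<dots> < top" using insert by simp
  finally show ?case .
qed simp

lemma hausdorff2_outer_compact_finite:
  fixes S :: "'a::metric_space set"
  assumes "compact S" and loc: "\<And>x. x \<in> S \<Longrightarrow> \<exists>r>0. hausdorff2_outer (ball x r \<inter> S) < top"
  shows "hausdorff2_outer S < top"
proof -
  obtain r where r: "\<And>x. x \<in> S \<Longrightarrow> 0 < r x \<and> hausdorff2_outer (ball x (r x) \<inter> S) < top"
    using loc by metis
  obtain F where F: "F \<subseteq> S" "finite F" "S \<subseteq> (\<Union>x\<in>F. ball x (r x))"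
    using compactE_image[OF assms(1), of S "\<lambda>x. ball x (r x)"] r by (metis (no_types, lifting) UN_I centre_in_ball open_ball subsetI)
  have "hausdorff2_outer (\<Union>x\<in>F. ball x (r x) \<inter> S) < top"
    using F r by (intro hausdorff2_outer_finite_UN) auto
  moreover have "S \<subseteq> (\<Union>x\<in>F. ball x (r x) \<inter> S)" using F by blast
  ultimately show ?thesis
    by (meson hausdorff2_outer_mono order_le_less_trans)
qed

section \<open>The regularized double-well potential\<close>

definition f0_deriv :: "real \<Rightarrow> real \<Rightarrow> real" where
  "f0_deriv K c =
     (if c > K then (3 * K\<^sup>2 - 1) * c - 2 * K^3
      else if c < - K then (3 * K\<^sup>2 - 1) * c + 2 * K^3
      else c^3 - c)"

lemma has_real_derivative_If_le:
  assumes "(f has_real_derivative f') (at x)" "(g has_real_derivative g') (at x)"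
    "x = a \<Longrightarrow> f a = g a" "x = a \<Longrightarrow> f' = g'"
  shows "((\<lambda>t. if t \<le> a then f t else g t) has_real_derivative (if x \<le> a then f' else g')) (at x)"
proof -
  have U: "{..a} \<union> {a<..} = (UNIV :: real set)" by auto
  have "((\<lambda>t. if t \<in> {..a} then f t else g t) has_derivative
     (if x \<in> {..a} then (*) f' else (*) g')) (at x within ({..a} \<union> {a<..}))"
    by (rule has_derivative_If_within_closures[where f' = "\<lambda>_. (*) f'" and g' = "\<lambda>_. (*) g'"])
       (use assms in \<open>auto simp: has_field_derivative_def intro: has_derivative_at_withinI\<close>)
  then show ?thesis unfolding U by (auto simp: has_field_derivative_def split: if_splits)
qed

text \<open>The two quadratic branches of the potential are the second-order Taylor extensions of the quartic at
  \<open>\<plusminus>K\<close>, so values and slopes match there.\<close>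

lemma f0_has_derivative:
  assumes "0 < K"
  shows "(f0 K has_real_derivative f0_deriv K x) (at x)"
proof -
  let ?m = "\<lambda>c. 1/4 * (c\<^sup>2 - 1)\<^sup>2 :: real"
  let ?r = "\<lambda>c. 1/2 * (3 * K\<^sup>2 - 1) * c\<^sup>2 - 2 * K^3 * c + 1/4 * (3 * K^4 + 1)"
  let ?l = "\<lambda>c. 1/2 * (3 * K\<^sup>2 - 1) * c\<^sup>2 + 2 * K^3 * c + 1/4 * (3 * K^4 + 1)"
  have m: "(?m has_real_derivative x^3 - x) (at x)"
    by (auto intro!: derivative_eq_intros simp: algebra_simps power2_eq_square power3_eq_cube)
  have r: "(?r has_real_derivative (3 * K\<^sup>2 - 1) * x - 2 * K^3) (at x)"
    by (auto intro!: derivative_eq_intros simp: algebra_simps)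
  have l: "(?l has_real_derivative (3 * K\<^sup>2 - 1) * x + 2 * K^3) (at x)"
    by (auto intro!: derivative_eq_intros simp: algebra_simps)
  have mr: "((\<lambda>t. if t \<le> K then ?m t else ?r t) has_real_derivative
      (if x \<le> K then x^3 - x else (3 * K\<^sup>2 - 1) * x - 2 * K^3)) (at x)"
    by (rule has_real_derivative_If_le[OF m r])
       (auto simp: field_simps power2_eq_square power3_eq_cube power4_eq_xxxx)
  have "((\<lambda>t. if t \<le> - K then ?l t else if t \<le> K then ?m t else ?r t) has_real_derivative
      (if x \<le> - K then (3 * K\<^sup>2 - 1) * x + 2 * K^3
       else if x \<le> K then x^3 - x else (3 * K\<^sup>2 - 1) * x - 2 * K^3)) (at x)"
    by (rule has_real_derivative_If_le[OF l mr])
       (use assms in \<open>auto simp: field_simps power2_eq_square power3_eq_cube power4_eq_xxxx\<close>)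
  moreover have "(\<lambda>t. if t \<le> - K then ?l t else if t \<le> K then ?m t else ?r t) = f0 K"
    using assms
    by (auto simp: fun_eq_iff f0_def not_le not_less le_less field_simps power2_eq_square
        power3_eq_cube power4_eq_xxxx)
  moreover have "(if x \<le> - K then (3 * K\<^sup>2 - 1) * x + 2 * K^3
       else if x \<le> K then x^3 - x else (3 * K\<^sup>2 - 1) * x - 2 * K^3) = f0_deriv K x"
    using assms by (auto simp: f0_deriv_def field_simps power2_eq_square power3_eq_cube)
  ultimately show ?thesis by simp
qed

lemma deriv_f0: "0 < K \<Longrightarrow> deriv (f0 K) = f0_deriv K"
  using f0_has_derivative DERIV_imp_deriv by blast

text \<open>With \<open>L = 3K\<^sup>2 - 1\<close>, the function \<open>L t - f\<^sub>0'(t)\<close> is the cubic \<open>3K\<^sup>2 s - s\<^sup>3\<close> evaluated at the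
  clamped argument \<open>s \<in> [-K, K]\<close>. This single formula shows both that it is continuous and, since the
  cubic increases on \<open>[-K, K]\<close>, that it is increasing.\<close>

lemma f0_deriv_eq_clamp:
  assumes "0 < K"
  shows "f0_deriv K t =
    (3 * K\<^sup>2 - 1) * t - (3 * K\<^sup>2 * max (- K) (min K t) - max (- K) (min K t) ^ 3)"
  using assms
  by (auto simp: f0_deriv_def algebra_simps power2_eq_square power3_eq_cube max_def min_def)

lemma f0_deriv_one_sided_lipschitz:
  assumes K: "0 < K" and "x \<le> y"
  shows "f0_deriv K y - f0_deriv K x \<le> (3 * K\<^sup>2 - 1) * (y - x)"
proof -
  define g where "g t = (3 * K\<^sup>2 - 1) * t - f0_deriv K t" for t
  define cl where "cl t = max (- K) (min K t)" for t
  have g: "g t = 3 * K\<^sup>2 * cl t - cl t ^ 3" for t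
    unfolding g_def cl_def f0_deriv_eq_clamp[OF K] by simp
  have c: "\<bar>cl t\<bar> \<le> K" for t using K by (auto simp: cl_def)
  have "cl x \<le> cl y" using assms by (auto simp: cl_def)
  moreover have "cl x ^ 2 \<le> K\<^sup>2" "cl y ^ 2 \<le> K\<^sup>2" using c K by (simp_all add: abs_le_square_iff[symmetric])
  moreover have "2 * (cl x * cl y) \<le> cl x ^2 + cl y ^2" using sum_squares_bound[of "cl x" "cl y"] by simp
  ultimately have "0 \<le> (cl y - cl x) * (3 * K\<^sup>2 - (cl x ^ 2 + cl x * cl y + cl y ^ 2))"
    by (intro mult_nonneg_nonneg) auto
  also have "\<dots> = g y - g x" unfolding g by algebra
  finally show ?thesis by (simp add: g_def algebra_simps)
qed

text \<open>The upper bound \<open>L\<close> of \<open>f\<^sub>0''\<close> in integrated form: \<open>L t\<^sup>2/2 - f\<^sub>0(t)\<close> is convex, because its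
  derivative increases, and therefore it lies above its tangents.\<close>

lemma f0_Taylor_upper_bound:
  assumes K: "0 < K"
  shows "f0 K y \<le> f0 K x + deriv (f0 K) x * (y - x) + (3 * K\<^sup>2 - 1) / 2 * (y - x)\<^sup>2"
proof -
  let ?L = "3 * K\<^sup>2 - 1"
  define h where "h t = ?L / 2 * t\<^sup>2 - f0 K t" for t
  have der: "(h has_real_derivative ?L * t - f0_deriv K t) (at t)" for t
    unfolding h_def by (auto intro!: derivative_eq_intros f0_has_derivative K)
  have "convex_on UNIV h"
    by (rule convex_on_realI[OF _ der]) (use f0_deriv_one_sided_lipschitz[OF K] in \<open>auto simp: algebra_simps\<close>)
  then have "(?L * x - f0_deriv K x) * (y - x) \<le> h y - h x"
    using convex_on_imp_above_tangent[of UNIV h x y] der by auto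
  then show ?thesis
    unfolding h_def deriv_f0[OF K] by (simp add: power2_eq_square field_simps)
qed

lemma continuous_f0: "0 < K \<Longrightarrow> continuous_on UNIV (f0 K)"
  by (meson DERIV_continuous_on f0_has_derivative has_field_derivative_at_within)

lemma continuous_deriv_f0:
  assumes "0 < K" shows "continuous_on UNIV (deriv (f0 K))"
proof -
  have "continuous_on UNIV (\<lambda>t. (3 * K\<^sup>2 - 1) * t -
      (3 * K\<^sup>2 * max (- K) (min K t) - max (- K) (min K t) ^ 3))"
    by (intro continuous_intros)
  then show ?thesis
    unfolding deriv_f0[OF assms] f0_deriv_eq_clamp[OF assms, abs_def] .
qed

section \<open>Elementwise gradients of finite element functions\<close>

text \<open>Derivatives relative to a convex body are unique even at its corners: the difference of two of them
  vanishes in the direction of every point of \<open>T\<close>, and these directions contain an open set.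
  This makes the one-sided gradients on the faces of a tetrahedron meaningful.\<close>

lemma has_derivative_unique_within_convex:
  fixes f :: "'a::real_normed_vector \<Rightarrow> real"
  assumes f: "(f has_derivative D) (at x within T)" "(f has_derivative D') (at x within T)"
    and T: "convex T" "interior T \<noteq> {}" and x: "x \<in> T"
  shows "D = D'"
proof -
  obtain z e where e: "0 < e" "ball z e \<subseteq> T"
    using T(2) by (metis ex_in_conv mem_interior)
  let ?E = "\<lambda>h. D h - D' h"
  have E: "((\<lambda>_. 0) has_derivative ?E) (at x within T)"
    using has_derivative_diff[OF f] by simp
  interpret E: bounded_linear ?E using E by (rule has_derivative_bounded_linear)
  have zero: "?E (v - x) = 0" if v: "v \<in> T" for v
  proof -
    let ?g = "\<lambda>t. x + t *\<^sub>R (v - x)"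
    have g: "?g ` {0..1} \<subseteq> T"
      using convexD_alt[OF T(1) x v] by (auto simp: algebra_simps)
    have "((\<lambda>_. 0) has_derivative ?E) (at (?g 0) within ?g ` {0..1})"
      using has_derivative_subset[OF E g] by simp
    moreover have "(?g has_derivative (\<lambda>t. t *\<^sub>R (v - x))) (at 0 within {0..1})"
      by (auto intro!: derivative_eq_intros)
    ultimately have "((\<lambda>_. 0) has_derivative (\<lambda>t. ?E (t *\<^sub>R (v - x)))) (at 0 within {0..1})"
      by (rule has_derivative_in_compose[rotated])
    then have "((\<lambda>_. 0) has_vector_derivative ?E (v - x)) (at 0 within {0..1})"
      unfolding has_vector_derivative_def E.scaleR by simp
    then show ?thesis
      using vector_derivative_unique_within_closed_interval[of 0 1 0 "\<lambda>_. 0 :: real" "?E (v - x)" 0]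
        has_vector_derivative_const by auto
  qed
  have "?E h = 0" for h
  proof (cases "h = 0")
    case False
    define s where "s = e / (2 * norm h)"
    have s: "0 < s" using e False by (simp add: s_def)
    have "norm (s *\<^sub>R h) < e" using e False by (simp add: s_def)
    then have "z + s *\<^sub>R h \<in> T" "z \<in> T" using e by (auto simp: dist_norm)
    then have "?E (z + s *\<^sub>R h - x) = 0" "?E (z - x) = 0" using zero by blast+
    moreover have "z + s *\<^sub>R h - x = (z - x) + s *\<^sub>R h" by simp
    ultimately have "s *\<^sub>R ?E h = 0" by (metis E.add E.scaleR add_0)
    then show ?thesis using s by simp
  qed (use E.zero in simp)
  then show ?thesis by (auto simp: fun_eq_iff)
qed

text \<open>Gradients are carried as explicit functions, so that an elementwise gradient can be recognized as the
  restriction of a continuous vector field defined on the whole space.\<close>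

definition has_continuous_gradient :: "(real^3 \<Rightarrow> real) \<Rightarrow> (real^3 \<Rightarrow> real^3) \<Rightarrow> bool" where
  "has_continuous_gradient p G \<longleftrightarrow>
     continuous_on UNIV G \<and> (\<forall>x. (p has_derivative (\<lambda>h. G x \<bullet> h)) (at x))"

lemma has_continuous_gradient_imp_continuous:
  "has_continuous_gradient p G \<Longrightarrow> continuous_on UNIV p"
  unfolding has_continuous_gradient_def
  by (meson continuous_at_imp_continuous_on has_derivative_continuous)

lemma has_continuous_gradient_const: "has_continuous_gradient (\<lambda>_. c) (\<lambda>_. 0)"
  by (simp add: has_continuous_gradient_def)

lemma has_continuous_gradient_component: "has_continuous_gradient (\<lambda>x. x $ i) (\<lambda>_. axis i 1)"
  by (auto simp: has_continuous_gradient_def inner_axis' intro!: bounded_linear_imp_has_derivative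
      bounded_linear_vec_nth)

lemma has_continuous_gradient_add:
  assumes "has_continuous_gradient p G" "has_continuous_gradient q H"
  shows "has_continuous_gradient (\<lambda>x. p x + q x) (\<lambda>x. G x + H x)"
  unfolding has_continuous_gradient_def
proof (intro conjI allI)
  show "continuous_on UNIV (\<lambda>x. G x + H x)"
    using assms by (auto simp: has_continuous_gradient_def intro: continuous_intros)
  show "((\<lambda>x. p x + q x) has_derivative (\<lambda>h. (G x + H x) \<bullet> h)) (at x)" for x
    using has_derivative_add[of p "\<lambda>h. G x \<bullet> h" "at x" q "\<lambda>h. H x \<bullet> h"] assms
    by (simp add: has_continuous_gradient_def inner_add_left)
qed

lemma has_continuous_gradient_diff:
  assumes "has_continuous_gradient p G" "has_continuous_gradient q H"
  shows "has_continuous_gradient (\<lambda>x. p x - q x) (\<lambda>x. G x - H x)"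
  unfolding has_continuous_gradient_def
proof (intro conjI allI)
  show "continuous_on UNIV (\<lambda>x. G x - H x)"
    using assms by (auto simp: has_continuous_gradient_def intro: continuous_intros)
  show "((\<lambda>x. p x - q x) has_derivative (\<lambda>h. (G x - H x) \<bullet> h)) (at x)" for x
    using has_derivative_diff[of p "\<lambda>h. G x \<bullet> h" "at x" q "\<lambda>h. H x \<bullet> h"] assms
    by (simp add: has_continuous_gradient_def inner_diff_left)
qed

lemma has_continuous_gradient_mult:
  assumes "has_continuous_gradient p G" "has_continuous_gradient q H"
  shows "has_continuous_gradient (\<lambda>x. p x * q x) (\<lambda>x. p x *\<^sub>R H x + q x *\<^sub>R G x)"
  unfolding has_continuous_gradient_def
proof (intro conjI allI)
  show "continuous_on UNIV (\<lambda>x. p x *\<^sub>R H x + q x *\<^sub>R G x)"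
    using assms by (intro continuous_intros has_continuous_gradient_imp_continuous)
       (auto simp: has_continuous_gradient_def)
  show "((\<lambda>x. p x * q x) has_derivative (\<lambda>h. (p x *\<^sub>R H x + q x *\<^sub>R G x) \<bullet> h)) (at x)" for x
    using has_derivative_mult[of p "\<lambda>h. G x \<bullet> h" x UNIV q "\<lambda>h. H x \<bullet> h"] assms
    by (simp add: has_continuous_gradient_def inner_add_left mult.commute)
qed

lemma polynomial_has_continuous_gradient:
  assumes "p \<in> polys k"
  obtains G where "has_continuous_gradient p G"
proof -
  have pow: "\<exists>G. has_continuous_gradient (\<lambda>x. x $ i ^ n) G" for i n
  proof (induction n)
    case (Suc n)
    then show ?case
      using has_continuous_gradient_mult[OF has_continuous_gradient_component] by auto
  qed (auto intro: has_continuous_gradient_const)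
  have mono: "\<exists>G. has_continuous_gradient (\<lambda>x. \<Prod>i\<in>I. x $ i ^ \<alpha> i) G" for I and \<alpha> :: "3 \<Rightarrow> nat"
  proof (induction I rule: infinite_finite_induct)
    case (insert i I)
    then show ?case
      using has_continuous_gradient_mult pow by fastforce
  qed (auto intro: has_continuous_gradient_const)
  have "\<exists>G. has_continuous_gradient (\<lambda>x. \<Sum>\<alpha>\<in>A. a \<alpha> * (\<Prod>i\<in>UNIV. x $ i ^ \<alpha> i)) G"
    for A and a :: "(3 \<Rightarrow> nat) \<Rightarrow> real"
  proof (induction A rule: infinite_finite_induct)
    case (insert \<alpha> A)
    then show ?case
      using has_continuous_gradient_add[OF has_continuous_gradient_mult[OF has_continuous_gradient_const]]
        mono[where I = UNIV and \<alpha> = \<alpha>] by fastforce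
  qed (auto intro: has_continuous_gradient_const)
  then show ?thesis
    using assms that unfolding polys_def by blast
qed

lemma polys_diff:
  assumes "p \<in> polys k" "r \<in> polys k"
  shows "(\<lambda>x. p x - r x) \<in> polys k"
proof -
  obtain a b where
    "p = (\<lambda>x. \<Sum>\<alpha> | (\<Sum>i\<in>UNIV. \<alpha> i) \<le> k. a \<alpha> * (\<Prod>i\<in>UNIV. x $ i ^ \<alpha> i))"
    "r = (\<lambda>x. \<Sum>\<alpha> | (\<Sum>i\<in>UNIV. \<alpha> i) \<le> k. b \<alpha> * (\<Prod>i\<in>UNIV. x $ i ^ \<alpha> i))"
    using assms unfolding polys_def by auto
  then have "(\<lambda>x. p x - r x) =
      (\<lambda>x. \<Sum>\<alpha> | (\<Sum>i\<in>UNIV. \<alpha> i) \<le> k. (a \<alpha> - b \<alpha>) * (\<Prod>i\<in>UNIV. x $ i ^ \<alpha> i))"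
    by (simp add: left_diff_distrib sum_subtractf)
  then show ?thesis
    unfolding polys_def mem_Collect_eq by (rule exI[of _ "\<lambda>\<alpha>. a \<alpha> - b \<alpha>"])
qed

lemma fe_space_polynomial:
  assumes "u \<in> fe_space \<S> k" "T \<in> \<S>"
  shows "\<exists>p. p \<in> polys k \<and> (\<forall>x\<in>T. u x = p x)"
  using assms by (auto simp: fe_space_def)

lemma fe_space_diff:
  assumes "u \<in> fe_space \<S> k" "v \<in> fe_space \<S> k"
  shows "(\<lambda>x. u x - v x) \<in> fe_space \<S> k"
proof -
  have "\<exists>p\<in>polys k. \<forall>x\<in>T. u x - v x = p x" if "T \<in> \<S>" for T
  proof -
    obtain p r where "p \<in> polys k" "\<forall>x\<in>T. u x = p x" "r \<in> polys k" "\<forall>x\<in>T. v x = r x"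
      using fe_space_polynomial[OF assms(1) \<open>T \<in> \<S>\<close>] fe_space_polynomial[OF assms(2) \<open>T \<in> \<S>\<close>] by metis
    then show ?thesis by (intro bexI[of _ "\<lambda>x. p x - r x"]) (auto intro: polys_diff)
  qed
  then show ?thesis
    using assms unfolding fe_space_def by (auto intro: continuous_on_diff)
qed

lemma fe_space_mono:
  assumes "\<S> \<subseteq> \<T>" shows "fe_space \<T> k \<subseteq> fe_space \<S> k"
  using assms unfolding fe_space_def by (auto intro: continuous_on_subset)

lemma tetrahedral_mesh_element:
  assumes "tetrahedral_mesh \<Omega> \<T>" "T \<in> \<T>"
  shows "compact T" "convex T" "interior T \<noteq> {}"
proof -
  have T: "3 simplex T" using assms by (auto simp: tetrahedral_mesh_def)
  then show "compact T" by (rule compact_simplex)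
  show conv: "convex T" using T by (rule convex_simplex)
  have "aff_dim T = 3" using T by (rule aff_dim_simplex)
  then have "interior T = rel_interior T" "T \<noteq> {}"
    by (auto simp: interior_rel_interior_gen aff_dim_eq_full)
  then show "interior T \<noteq> {}" using conv by (simp add: rel_interior_eq_empty)
qed

lemma grad_within_eqI:
  assumes "convex T" "interior T \<noteq> {}" "x \<in> T"
    and G: "has_continuous_gradient p G" and eq: "\<And>y. y \<in> T \<Longrightarrow> u y = p y"
  shows "grad u (at x within T) = G x"
proof -
  have "(p has_derivative (\<lambda>h. G x \<bullet> h)) (at x within T)"
    using G by (auto simp: has_continuous_gradient_def intro: has_derivative_at_withinI)
  then have d: "(u has_derivative (\<lambda>h. G x \<bullet> h)) (at x within T)"
    by (rule has_derivative_transform[where f = p and g = u, OF assms(3) eq, rotated])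
  then have "(u has_derivative frechet_derivative u (at x within T)) (at x within T)"
    using frechet_derivative_works differentiable_def by blast
  then have "frechet_derivative u (at x within T) = (\<lambda>h. G x \<bullet> h)"
    using has_derivative_unique_within_convex[OF _ d] assms by blast
  then show ?thesis by (simp add: grad_def vec_eq_iff inner_axis)
qed

text \<open>On one element a finite element function agrees with a globally smooth polynomial; its one-sided
  gradient there is the gradient of that polynomial, up to and including the boundary.\<close>

lemma fe_space_elementwise_gradient:
  assumes "u \<in> fe_space \<S> k" "T \<in> \<S>" "convex T" "interior T \<noteq> {}"
  obtains p G where "has_continuous_gradient p G" "\<And>x. x \<in> T \<Longrightarrow> u x = p x"
    "\<And>x. x \<in> T \<Longrightarrow> grad u (at x within T) = G x"
proof -
  obtain p where p: "p \<in> polys k" "\<forall>x\<in>T. u x = p x"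
    using fe_space_polynomial[OF assms(1,2)] by metis
  obtain G where G: "has_continuous_gradient p G"
    by (rule polynomial_has_continuous_gradient[OF p(1)])
  have "grad u (at x within T) = G x" if "x \<in> T" for x
    by (rule grad_within_eqI[OF assms(3,4) that G]) (simp add: p)
  then show ?thesis using that G p(2) by blast
qed

lemma grad_within_diff:
  assumes "u \<in> fe_space \<S> k" "v \<in> fe_space \<S> k" "T \<in> \<S>" "convex T" "interior T \<noteq> {}" "x \<in> T"
  shows "grad (\<lambda>x. u x - v x) (at x within T) = grad u (at x within T) - grad v (at x within T)"
proof -
  obtain p G where p: "has_continuous_gradient p G" "\<And>x. x \<in> T \<Longrightarrow> u x = p x"
    "\<And>x. x \<in> T \<Longrightarrow> grad u (at x within T) = G x"
    using fe_space_elementwise_gradient[OF assms(1,3,4,5)] by blast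
  obtain r H where r: "has_continuous_gradient r H" "\<And>x. x \<in> T \<Longrightarrow> v x = r x"
    "\<And>x. x \<in> T \<Longrightarrow> grad v (at x within T) = H x"
    using fe_space_elementwise_gradient[OF assms(2,3,4,5)] by blast
  have "grad (\<lambda>x. u x - v x) (at x within T) = G x - H x"
    by (rule grad_within_eqI[OF assms(4-6) has_continuous_gradient_diff[OF p(1) r(1)]])
       (simp add: p r)
  then show ?thesis using p(3) r(3) assms(6) by simp
qed

section \<open>Bounded measurable integrands\<close>

text \<open>The element selected at \<open>x\<close> depends only on the set of all elements that contain \<open>x\<close>. This set
  takes finitely many values, each of them on a Borel set, and so the result is measurable whatever
  the selection does.\<close>

lemma borel_measurable_pick:
  fixes g :: "'a::topological_space set \<Rightarrow> 'a \<Rightarrow> 'b::{second_countable_topology, topological_monoid_add,real_normed_vector}"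
  assumes fin: "finite \<S>" and cl: "\<And>T. T \<in> \<S> \<Longrightarrow> closed T"
    and g: "\<And>T. T \<in> \<S> \<Longrightarrow> g T \<in> borel_measurable borel"
  shows "(\<lambda>x. indicat_real (\<Union>\<S>) x *\<^sub>R g (SOME T. T \<in> \<S> \<and> x \<in> T) x) \<in> borel_measurable borel"
proof -
  let ?A = "\<lambda>\<U>. \<Inter>\<U> - \<Union>(\<S> - \<U>)"
  let ?h = "\<lambda>x. \<Sum>\<U>\<in>Pow \<S> - {{}}. indicat_real (?A \<U>) x *\<^sub>R g (SOME T. T \<in> \<U>) x"
  have "indicat_real (\<Union>\<S>) x *\<^sub>R g (SOME T. T \<in> \<S> \<and> x \<in> T) x = ?h x" for x
  proof -
    let ?V = "{T \<in> \<S>. x \<in> T}"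
    have "x \<in> ?A \<U> \<longleftrightarrow> \<U> = ?V" if "\<U> \<subseteq> \<S>" for \<U> using that by auto
    then have "?h x = (\<Sum>\<U>\<in>Pow \<S> - {{}}. if \<U> = ?V then g (SOME T. T \<in> \<U>) x else 0)"
      by (intro sum.cong) (auto simp: indicator_def)
    also have "\<dots> = (if ?V = {} then 0 else g (SOME T. T \<in> ?V) x)"
      using fin by (subst sum.delta) auto
    finally show ?thesis by (auto simp: indicator_def)
  qed
  moreover have "?h \<in> borel_measurable borel"
  proof (intro borel_measurable_sum borel_measurable_scaleR borel_measurable_indicator)
    fix \<U> assume U: "\<U> \<in> Pow \<S> - {{}}"
    then have "finite \<U>" "\<U> \<noteq> {}" using fin by (auto intro: finite_subset)
    then show "?A \<U> \<in> sets borel"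
      using U fin cl by (intro sets.Diff borel_closed closed_Inter closed_Union) auto
    have "(SOME T. T \<in> \<U>) \<in> \<U>" using \<open>\<U> \<noteq> {}\<close> by (simp add: some_in_eq)
    then show "g (SOME T. T \<in> \<U>) \<in> borel_measurable borel" using g U by auto
  qed
  ultimately show ?thesis by simp
qed

text \<open>All integrands of the forms lie in this class of functions, which is closed under the operations
  that build them, and whose members are integrable over every Borel subset of \<open>D\<close> of finite
  measure. The indicator is part of the measurability condition because nothing is known about the
  integrands outside \<open>D\<close>.\<close>

definition bounded_measurable_on :: "'a::topological_space set \<Rightarrow> ('a \<Rightarrow> 'b::euclidean_space) \<Rightarrow> bool" where
  "bounded_measurable_on D f \<longleftrightarrow>
     (\<lambda>x. indicat_real D x *\<^sub>R f x) \<in> borel_measurable borel \<and> (\<exists>B. \<forall>x\<in>D. norm (f x) \<le> B)"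

lemma bounded_measurable_on_diff:
  assumes "bounded_measurable_on D f" "bounded_measurable_on D g"
  shows "bounded_measurable_on D (\<lambda>x. f x - g x)"
proof -
  obtain A B where "\<forall>x\<in>D. norm (f x) \<le> A" "\<forall>x\<in>D. norm (g x) \<le> B"
    using assms unfolding bounded_measurable_on_def by blast
  then have "\<forall>x\<in>D. norm (f x - g x) \<le> A + B"
    by (metis norm_triangle_le_diff add_mono)
  then show ?thesis
    using assms unfolding bounded_measurable_on_def by (auto simp: scaleR_diff_right)
qed

lemma bounded_measurable_on_inner:
  assumes "bounded_measurable_on D f" "bounded_measurable_on D g"
  shows "bounded_measurable_on D (\<lambda>x. f x \<bullet> g x)"
proof -
  obtain A B where AB: "\<forall>x\<in>D. norm (f x) \<le> A" "\<forall>x\<in>D. norm (g x) \<le> B"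
    using assms unfolding bounded_measurable_on_def by blast
  have "norm (f x \<bullet> g x) \<le> A * B" if "x \<in> D" for x
  proof -
    have "norm (f x \<bullet> g x) \<le> norm (f x) * norm (g x)"
      using Cauchy_Schwarz_ineq2 by simp
    also have "\<dots> \<le> A * B"
      using AB that by (intro mult_mono) (auto intro: order_trans[OF norm_ge_zero])
    finally show ?thesis .
  qed
  moreover have eq: "(\<lambda>x. indicat_real D x *\<^sub>R (f x \<bullet> g x)) =
      (\<lambda>x. (indicat_real D x *\<^sub>R f x) \<bullet> (indicat_real D x *\<^sub>R g x))"
    by (auto simp: indicator_def)
  moreover have "(\<lambda>x. (indicat_real D x *\<^sub>R f x) \<bullet> (indicat_real D x *\<^sub>R g x)) \<in> borel_measurable borel"
    using assms unfolding bounded_measurable_on_def by - (rule borel_measurable_inner; blast)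
  ultimately show ?thesis
    unfolding bounded_measurable_on_def eq by blast
qed

lemma bounded_measurable_on_scaleR:
  fixes f :: "'a::topological_space \<Rightarrow> real" and g :: "'a \<Rightarrow> 'b::euclidean_space"
  assumes "bounded_measurable_on D f" "bounded_measurable_on D g"
  shows "bounded_measurable_on D (\<lambda>x. f x *\<^sub>R g x)"
proof -
  obtain A B where AB: "\<forall>x\<in>D. norm (f x) \<le> A" "\<forall>x\<in>D. norm (g x) \<le> B"
    using assms unfolding bounded_measurable_on_def by blast
  have "norm (f x *\<^sub>R g x) \<le> A * B" if "x \<in> D" for x
    using AB that unfolding norm_scaleR real_norm_def[symmetric]
    by (intro mult_mono) (auto intro: order_trans[OF norm_ge_zero])
  moreover have eq: "(\<lambda>x. indicat_real D x *\<^sub>R (f x *\<^sub>R g x)) =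
      (\<lambda>x. (indicat_real D x *\<^sub>R f x) *\<^sub>R (indicat_real D x *\<^sub>R g x))"
    by (auto simp: indicator_def)
  moreover have "(\<lambda>x. (indicat_real D x *\<^sub>R f x) *\<^sub>R (indicat_real D x *\<^sub>R g x)) \<in> borel_measurable borel"
    using assms unfolding bounded_measurable_on_def by - (rule borel_measurable_scaleR; blast)
  ultimately show ?thesis
    unfolding bounded_measurable_on_def eq by blast
qed

lemma bounded_measurable_on_continuous:
  fixes f :: "'a::metric_space \<Rightarrow> 'b::euclidean_space"
  assumes "compact D" "continuous_on D f"
  shows "bounded_measurable_on D f"
proof -
  have "bounded (f ` D)" using assms by (simp add: compact_continuous_image compact_imp_bounded)
  then show ?thesis
    using assms unfolding bounded_measurable_on_def
    by (auto simp: bounded_iff intro: borel_measurable_continuous_on_indicator borel_compact)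
qed

lemma set_integrable_bounded_measurable_on:
  assumes f: "bounded_measurable_on D f" and M: "sets M = sets borel"
    and A: "A \<in> sets borel" "A \<subseteq> D" "emeasure M A < top"
  shows "set_integrable M A f"
proof -
  obtain B where B: "\<forall>x\<in>D. norm (f x) \<le> B"
    using f unfolding bounded_measurable_on_def by blast
  have "(\<lambda>x. indicat_real D x *\<^sub>R f x) \<in> borel_measurable borel"
    using f by (simp only: bounded_measurable_on_def)
  then have "(\<lambda>x. indicat_real A x *\<^sub>R (indicat_real D x *\<^sub>R f x)) \<in> borel_measurable borel"
    by (rule borel_measurable_scaleR[OF borel_measurable_indicator[OF A(1)]])
  also have "(\<lambda>x. indicat_real A x *\<^sub>R (indicat_real D x *\<^sub>R f x)) = (\<lambda>x. indicat_real A x *\<^sub>R f x)"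
    using A(2) by (auto simp: indicator_def fun_eq_iff)
  finally have meas: "(\<lambda>x. indicat_real A x *\<^sub>R f x) \<in> borel_measurable M"
    by (simp add: measurable_cong_sets[OF M refl])
  show ?thesis
    unfolding set_integrable_def
  proof (rule integrableI_bounded_set[where A = A and B = B])
    show "A \<in> sets M" using A(1) M by simp
    show "AE x in M. x \<in> A \<longrightarrow> norm (indicat_real A x *\<^sub>R f x) \<le> B" using A(2) B by auto
    show "emeasure M A < \<infinity>" using A(3) by simp
  qed (use meas in \<open>auto simp: indicator_def\<close>)
qed

section \<open>Discrete surface and integrability of the forms\<close>

lemma proj_matrix_mult: "proj_matrix \<nu> *v w = w - (\<nu> \<bullet> w) *\<^sub>R \<nu>"
proof -
  let ?A = "(columnvector \<nu> :: real^1^3) ** (rowvector \<nu> :: real^3^1)"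
  have "?A $ i $ j = \<nu> $ i * \<nu> $ j" for i j
    by (simp add: matrix_matrix_mult_def columnvector_def rowvector_def)
  then have "?A *v w = (\<nu> \<bullet> w) *\<^sub>R \<nu>"
    by (simp add: vec_eq_iff matrix_vector_mult_def inner_vec_def sum_distrib_left ac_simps)
  then show ?thesis by (simp add: proj_matrix_def matrix_vector_mult_diff_rdistrib)
qed

lemma discrete_surface_subset_cut_domain: "discrete_surface \<T> \<phi>h \<subseteq> cut_domain \<T> \<phi>h"
  by (auto simp: discrete_surface_def cut_domain_def cut_mesh_def)

locale cut_surface_mesh =
  fixes \<Omega> :: "(real^3) set" and \<T> :: "(real^3) set set" and \<phi>h :: "real^3 \<Rightarrow> real" and q :: nat
  assumes mesh: "tetrahedral_mesh \<Omega> \<T>" and nonempty: "\<Omega> \<noteq> {}"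
    and level_set: "\<phi>h \<in> fe_space \<T> q" and regular: "nondegenerate \<T> \<phi>h"
begin

abbreviation "\<Gamma>h \<equiv> discrete_surface \<T> \<phi>h"
abbreviation "\<Omega>h \<equiv> cut_domain \<T> \<phi>h"

lemma finite_mesh: "finite \<T>"
  using mesh by (simp add: tetrahedral_mesh_def triangulation_def)

lemma cut_subset: "cut_mesh \<T> \<phi>h \<subseteq> \<T>"
  by (auto simp: cut_mesh_def)

lemma finite_cut: "finite (cut_mesh \<T> \<phi>h)"
  using cut_subset finite_mesh by (rule finite_subset)

lemma cut_element:
  assumes "T \<in> cut_mesh \<T> \<phi>h"
  shows "compact T" "convex T" "interior T \<noteq> {}"
  using tetrahedral_mesh_element[OF mesh] assms cut_subset by blast+

lemma compact_cut_domain: "compact \<Omega>h"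
  unfolding cut_domain_def using finite_cut cut_element by (intro compact_Union) auto

lemma compact_discrete_surface: "compact \<Gamma>h"
proof -
  have U: "compact (\<Union>\<T>)" using finite_mesh tetrahedral_mesh_element[OF mesh] by (intro compact_Union) auto
  have "closed \<Gamma>h"
    unfolding discrete_surface_def using level_set U
    by (intro continuous_closed_preimage_constant) (auto simp: fe_space_def compact_imp_closed)
  moreover have "\<Gamma>h = \<Union>\<T> \<inter> \<Gamma>h" by (auto simp: discrete_surface_def)
  ultimately show ?thesis using U by (metis compact_Int_closed)
qed

lemma mesh_size_nonneg: "0 \<le> mesh_size \<T>"
proof -
  have "closure \<Omega> \<noteq> {}" using nonempty by simp
  then have "\<T> \<noteq> {}" using mesh unfolding tetrahedral_mesh_def by (metis Union_empty)
  then obtain T where T: "T \<in> \<T>" by blast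
  then have "0 \<le> diameter T"
    using tetrahedral_mesh_element[OF mesh] by (intro diameter_ge_0 compact_imp_bounded) auto
  also have "\<dots> \<le> mesh_size \<T>"
    unfolding mesh_size_def using T finite_mesh by (intro Max_ge) auto
  finally show ?thesis .
qed

text \<open>In each of the finitely many cut tetrahedra \<open>\<Gamma>\<^sub>h\<close> is a compact piece of the zero set of a
  polynomial, and nondegeneracy makes every point of it a regular zero. If the area were
  infinite, integrals over \<open>\<Gamma>\<^sub>h\<close> could take the default value 0 of a divergent integral, and
  additivity could fail.\<close>

lemma emeasure_discrete_surface_finite: "emeasure hausdorff2 \<Gamma>h < top"
proof -
  have fin: "hausdorff2_outer (\<Gamma>h \<inter> T) < top" if T: "T \<in> cut_mesh \<T> \<phi>h" for T
  proof (rule hausdorff2_outer_compact_finite)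
    show "compact (\<Gamma>h \<inter> T)"
      using compact_discrete_surface cut_element(1)[OF T] by (intro compact_Int)
    fix x assume x: "x \<in> \<Gamma>h \<inter> T"
    have "T \<in> \<T>" using T cut_subset by blast
    then obtain p G where p: "has_continuous_gradient p G" "\<And>x. x \<in> T \<Longrightarrow> \<phi>h x = p x"
      "\<And>x. x \<in> T \<Longrightarrow> grad \<phi>h (at x within T) = G x"
      using fe_space_elementwise_gradient[OF level_set _ cut_element(2,3)[OF T]] by blast
    have "G x \<noteq> 0" using regular T x p(3)[of x] unfolding nondegenerate_def by auto
    then obtain r where r: "0 < r" "hausdorff2_outer (ball x r \<inter> {y. p y = 0}) < top"
      using hausdorff2_outer_regular_zero_set_locally_finite[of p G x] p(1)
      unfolding has_continuous_gradient_def by blast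
    have "ball x r \<inter> (\<Gamma>h \<inter> T) \<subseteq> ball x r \<inter> {y. p y = 0}"
      using p(2) by (auto simp: discrete_surface_def)
    then have "hausdorff2_outer (ball x r \<inter> (\<Gamma>h \<inter> T)) < top"
      using r(2) hausdorff2_outer_mono by (meson order_le_less_trans)
    then show "\<exists>r>0. hausdorff2_outer (ball x r \<inter> (\<Gamma>h \<inter> T)) < top" using r(1) by blast
  qed
  have "\<Gamma>h \<subseteq> (\<Union>T\<in>cut_mesh \<T> \<phi>h. \<Gamma>h \<inter> T)"
    using discrete_surface_subset_cut_domain[of \<T> \<phi>h] by (auto simp: cut_domain_def)
  then have "hausdorff2_outer \<Gamma>h < top"
    using hausdorff2_outer_finite_UN[OF finite_cut fin] hausdorff2_outer_mono
    by (meson order_le_less_trans)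
  then show ?thesis
    using compact_discrete_surface by (subst emeasure_hausdorff2) (auto intro: borel_compact)
qed

lemma set_integrable_surface:
  assumes "bounded_measurable_on D f" "\<Gamma>h \<subseteq> D"
  shows "set_integrable hausdorff2 \<Gamma>h f"
  using assms compact_discrete_surface emeasure_discrete_surface_finite
  by (intro set_integrable_bounded_measurable_on) (auto intro: borel_compact)

lemma set_integrable_bulk:
  assumes "bounded_measurable_on \<Omega>h f"
  shows "set_integrable lborel \<Omega>h f"
proof (rule set_integrable_bounded_measurable_on[OF assms])
  show "emeasure lborel \<Omega>h < top"
    using emeasure_bounded_finite[OF compact_imp_bounded[OF compact_cut_domain]] by simp
qed (use compact_cut_domain in \<open>auto intro: borel_compact\<close>)

lemma set_integrable_surface_continuous:
  fixes f :: "real^3 \<Rightarrow> real"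
  assumes "continuous_on \<Gamma>h f"
  shows "set_integrable hausdorff2 \<Gamma>h f"
  using bounded_measurable_on_continuous[OF compact_discrete_surface assms] set_integrable_surface by blast

lemma selected_element:
  assumes "x \<in> \<Omega>h"
  shows "(SOME T. T \<in> cut_mesh \<T> \<phi>h \<and> x \<in> T) \<in> cut_mesh \<T> \<phi>h"
    "x \<in> (SOME T. T \<in> cut_mesh \<T> \<phi>h \<and> x \<in> T)"
proof -
  have "\<exists>T. T \<in> cut_mesh \<T> \<phi>h \<and> x \<in> T" using assms by (auto simp: cut_domain_def)
  from someI_ex[OF this] show
    "(SOME T. T \<in> cut_mesh \<T> \<phi>h \<and> x \<in> T) \<in> cut_mesh \<T> \<phi>h"
    "x \<in> (SOME T. T \<in> cut_mesh \<T> \<phi>h \<and> x \<in> T)" by simp_all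
qed

lemma pw_grad_diff:
  assumes "u \<in> Vh \<T> \<phi>h k" "v \<in> Vh \<T> \<phi>h k" "x \<in> \<Omega>h"
  shows "pw_grad \<T> \<phi>h (\<lambda>x. u x - v x) x = pw_grad \<T> \<phi>h u x - pw_grad \<T> \<phi>h v x"
  unfolding pw_grad_def
  using selected_element[OF assms(3)] assms(1,2) cut_element by (intro grad_within_diff) auto

text \<open>On each tetrahedron the gradient is the restriction of a continuous field; compactness of the
  finitely many tetrahedra bounds it.\<close>

lemma bounded_measurable_pw_grad:
  assumes "u \<in> Vh \<T> \<phi>h k"
  shows "bounded_measurable_on \<Omega>h (pw_grad \<T> \<phi>h u)"
proof -
  have "\<exists>g. continuous_on UNIV g \<and> (\<forall>x\<in>T. grad u (at x within T) = g x)"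
    if "T \<in> cut_mesh \<T> \<phi>h" for T
    using fe_space_elementwise_gradient[OF assms that cut_element(2,3)[OF that]]
    unfolding has_continuous_gradient_def by metis
  then obtain g where cont: "\<And>T. T \<in> cut_mesh \<T> \<phi>h \<Longrightarrow> continuous_on UNIV (g T)"
    and g: "\<And>T x. T \<in> cut_mesh \<T> \<phi>h \<Longrightarrow> x \<in> T \<Longrightarrow> grad u (at x within T) = g T x"
    by metis
  have eq: "pw_grad \<T> \<phi>h u x = g (SOME T. T \<in> cut_mesh \<T> \<phi>h \<and> x \<in> T) x" if "x \<in> \<Omega>h" for x
    unfolding pw_grad_def by (intro g selected_element that)
  have "(\<lambda>x. indicat_real \<Omega>h x *\<^sub>R g (SOME T. T \<in> cut_mesh \<T> \<phi>h \<and> x \<in> T) x) \<in> borel_measurable borel"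
    unfolding cut_domain_def using cont finite_cut cut_element(1)
    by (intro borel_measurable_pick borel_measurable_continuous_onI) (auto intro: compact_imp_closed)
  also have "(\<lambda>x. indicat_real \<Omega>h x *\<^sub>R g (SOME T. T \<in> cut_mesh \<T> \<phi>h \<and> x \<in> T) x) =
      (\<lambda>x. indicat_real \<Omega>h x *\<^sub>R pw_grad \<T> \<phi>h u x)"
    (is "?l = ?r")
  proof (rule ext)
    show "?l x = ?r x" for x by (cases "x \<in> \<Omega>h") (simp_all add: eq)
  qed
  finally have meas: "(\<lambda>x. indicat_real \<Omega>h x *\<^sub>R pw_grad \<T> \<phi>h u x) \<in> borel_measurable borel" .
  have "compact (g T ` T)" if "T \<in> cut_mesh \<T> \<phi>h" for T
    using cont[OF that] cut_element(1)[OF that]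
    by (intro compact_continuous_image continuous_on_subset[OF cont[OF that]]) auto
  then have "bounded (\<Union>T\<in>cut_mesh \<T> \<phi>h. g T ` T)"
    using finite_cut by (intro bounded_UN) (auto intro: compact_imp_bounded)
  then obtain B where B: "\<And>T x. T \<in> cut_mesh \<T> \<phi>h \<Longrightarrow> x \<in> T \<Longrightarrow> norm (g T x) \<le> B"
    unfolding bounded_iff by blast
  have "\<forall>x\<in>\<Omega>h. norm (pw_grad \<T> \<phi>h u x) \<le> B"
    using eq B selected_element by simp
  then show ?thesis using meas unfolding bounded_measurable_on_def by blast
qed

text \<open>The normal is a Borel function of the elementwise gradient and has length at most 1, also at those
  points of the cut tetrahedra where the gradient vanishes and the normalization gives 0.\<close>

lemma bounded_measurable_discrete_normal: "bounded_measurable_on \<Omega>h (discrete_normal \<T> \<phi>h)"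
proof -
  define w where "w x = indicat_real \<Omega>h x *\<^sub>R pw_grad \<T> \<phi>h \<phi>h x" for x
  have "\<phi>h \<in> Vh \<T> \<phi>h q" using level_set fe_space_mono[OF cut_subset] by blast
  then have w: "w \<in> borel_measurable borel"
    using bounded_measurable_pw_grad unfolding bounded_measurable_on_def w_def by blast
  have "(\<lambda>x. indicat_real \<Omega>h x *\<^sub>R discrete_normal \<T> \<phi>h x) = (\<lambda>x. inverse (norm (w x)) *\<^sub>R w x)"
    by (auto simp: w_def discrete_normal_def indicator_def)
  moreover have "(\<lambda>x. inverse (norm (w x)) *\<^sub>R w x) \<in> borel_measurable borel"
    using w by measurable
  moreover have "norm (discrete_normal \<T> \<phi>h x) \<le> 1" for x
    by (cases "pw_grad \<T> \<phi>h \<phi>h x = 0") (simp_all add: discrete_normal_def)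
  ultimately show ?thesis unfolding bounded_measurable_on_def by auto
qed

lemma discrete_surface_grad_eq:
  "discrete_surface_grad \<T> \<phi>h u x =
     pw_grad \<T> \<phi>h u x - (discrete_normal \<T> \<phi>h x \<bullet> pw_grad \<T> \<phi>h u x) *\<^sub>R discrete_normal \<T> \<phi>h x"
  by (simp add: discrete_surface_grad_def proj_matrix_mult)

lemma surface_integrand_integrable:
  assumes "u \<in> Vh \<T> \<phi>h k" "v \<in> Vh \<T> \<phi>h k"
  shows "set_integrable hausdorff2 \<Gamma>h
    (\<lambda>x. discrete_surface_grad \<T> \<phi>h u x \<bullet> discrete_surface_grad \<T> \<phi>h v x)"
  unfolding discrete_surface_grad_eq
  by (intro set_integrable_surface[OF _ discrete_surface_subset_cut_domain]
      bounded_measurable_on_inner bounded_measurable_on_diff bounded_measurable_on_scaleR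
      bounded_measurable_pw_grad[OF assms(1)] bounded_measurable_pw_grad[OF assms(2)]
      bounded_measurable_discrete_normal)

lemma bulk_integrand_integrable:
  assumes "u \<in> Vh \<T> \<phi>h k" "v \<in> Vh \<T> \<phi>h k"
  shows "set_integrable lborel \<Omega>h
    (\<lambda>x. (discrete_normal \<T> \<phi>h x \<bullet> pw_grad \<T> \<phi>h u x) * (discrete_normal \<T> \<phi>h x \<bullet> pw_grad \<T> \<phi>h v x))"
  unfolding real_scaleR_def[symmetric]
  by (intro set_integrable_bulk bounded_measurable_on_inner bounded_measurable_on_scaleR
      bounded_measurable_pw_grad[OF assms(1)] bounded_measurable_pw_grad[OF assms(2)]
      bounded_measurable_discrete_normal)

end

section \<open>Stability of one time step\<close>

context cut_surface_mesh
begin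

lemma a_h_commute: "a_h \<T> \<phi>h u v = a_h \<T> \<phi>h v u"
  by (simp add: a_h_def inner_commute mult.commute)

text \<open>Additivity of the integral needs integrable integrands; this is the point where the finite area of
  \<open>\<Gamma>\<^sub>h\<close> and the measurability of the elementwise gradients are used for the form.\<close>

lemma a_h_diff_right:
  assumes "u \<in> Vh \<T> \<phi>h k" "v \<in> Vh \<T> \<phi>h k" "w \<in> Vh \<T> \<phi>h k"
  shows "a_h \<T> \<phi>h u (\<lambda>x. v x - w x) = a_h \<T> \<phi>h u v - a_h \<T> \<phi>h u w"
proof -
  let ?g = "discrete_surface_grad \<T> \<phi>h" and ?p = "pw_grad \<T> \<phi>h" and ?n = "discrete_normal \<T> \<phi>h"
  let ?d = "\<lambda>x. v x - w x"
  have borel: "\<Gamma>h \<in> sets hausdorff2" "\<Omega>h \<in> sets lborel"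
    using compact_discrete_surface compact_cut_domain by (auto intro: borel_compact)
  have p: "?p ?d x = ?p v x - ?p w x" if "x \<in> \<Omega>h" for x
    using pw_grad_diff assms that by blast
  then have g: "?g ?d x = ?g v x - ?g w x" if "x \<in> \<Gamma>h" for x
    using that discrete_surface_subset_cut_domain[of \<T> \<phi>h]
    by (auto simp: discrete_surface_grad_def matrix_vector_mult_diff_distrib)
  have "(LINT x:\<Gamma>h|hausdorff2. ?g u x \<bullet> ?g ?d x) =
      (LINT x:\<Gamma>h|hausdorff2. ?g u x \<bullet> ?g v x - ?g u x \<bullet> ?g w x)"
    using borel g by (intro set_lebesgue_integral_cong) (auto simp: inner_diff_right)
  also have "\<dots> = (LINT x:\<Gamma>h|hausdorff2. ?g u x \<bullet> ?g v x) - (LINT x:\<Gamma>h|hausdorff2. ?g u x \<bullet> ?g w x)"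
    using surface_integrand_integrable assms by (intro set_integral_diff(2)) auto
  finally have S: "(LINT x:\<Gamma>h|hausdorff2. ?g u x \<bullet> ?g ?d x) = \<dots>" .
  have "(LINT x:\<Omega>h|lborel. (?n x \<bullet> ?p u x) * (?n x \<bullet> ?p ?d x)) =
      (LINT x:\<Omega>h|lborel. (?n x \<bullet> ?p u x) * (?n x \<bullet> ?p v x) - (?n x \<bullet> ?p u x) * (?n x \<bullet> ?p w x))"
    using borel p by (intro set_lebesgue_integral_cong) (auto simp: inner_diff_right right_diff_distrib)
  also have "\<dots> = (LINT x:\<Omega>h|lborel. (?n x \<bullet> ?p u x) * (?n x \<bullet> ?p v x)) -
      (LINT x:\<Omega>h|lborel. (?n x \<bullet> ?p u x) * (?n x \<bullet> ?p w x))"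
    using bulk_integrand_integrable assms by (intro set_integral_diff(2)) auto
  finally have B: "(LINT x:\<Omega>h|lborel. (?n x \<bullet> ?p u x) * (?n x \<bullet> ?p ?d x)) = \<dots>" .
  show ?thesis unfolding a_h_def S B by (simp add: right_diff_distrib)
qed

lemma a_h_nonneg: "0 \<le> a_h \<T> \<phi>h u u"
  unfolding a_h_def set_lebesgue_integral_def
  by (intro add_nonneg_nonneg mult_nonneg_nonneg mesh_size_nonneg Bochner_Integration.integral_nonneg) auto

lemma a_h_polarization:
  assumes "u \<in> Vh \<T> \<phi>h k" "v \<in> Vh \<T> \<phi>h k"
  shows "2 * a_h \<T> \<phi>h v (\<lambda>x. v x - u x) =
    a_h \<T> \<phi>h v v - a_h \<T> \<phi>h u u + a_h \<T> \<phi>h (\<lambda>x. v x - u x) (\<lambda>x. v x - u x)"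
proof -
  let ?d = "\<lambda>x. v x - u x"
  have d: "?d \<in> Vh \<T> \<phi>h k" by (rule fe_space_diff[OF assms(2,1)])
  show ?thesis
    using a_h_diff_right[OF assms(2,2,1)] a_h_diff_right[OF assms(1,2,1)] a_h_diff_right[OF d assms(2,1)]
      a_h_commute[of ?d v] a_h_commute[of ?d u] a_h_commute[of u v]
    by linarith
qed

lemma fe_continuous_on_surface:
  assumes "u \<in> Vh \<T> \<phi>h k" shows "continuous_on \<Gamma>h u"
  using assms discrete_surface_subset_cut_domain[of \<T> \<phi>h]
  by (auto simp: fe_space_def cut_domain_def intro: continuous_on_subset)

text \<open>The explicit treatment of \<open>f\<^sub>0'\<close> costs at most \<open>L/2\<close> times the squared \<open>L\<^sup>2\<close>-norm of the
  increment; this is the term that the stabilization \<open>\<beta>\<^sub>s\<close> has to absorb.\<close>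

lemma potential_increment_le:
  assumes K: "0 < K" and u: "u \<in> Vh \<T> \<phi>h k" and v: "v \<in> Vh \<T> \<phi>h k"
  shows "(LINT x:\<Gamma>h|hausdorff2. f0 K (v x)) - (LINT x:\<Gamma>h|hausdorff2. f0 K (u x)) \<le>
    ip_h \<T> \<phi>h (\<lambda>x. deriv (f0 K) (u x)) (\<lambda>x. v x - u x) +
    (3 * K\<^sup>2 - 1) / 2 * ip_h \<T> \<phi>h (\<lambda>x. v x - u x) (\<lambda>x. v x - u x)"
proof -
  let ?d = "\<lambda>x. v x - u x"
  note cont = fe_continuous_on_surface[OF u] fe_continuous_on_surface[OF v]
  have f0: "continuous_on \<Gamma>h (\<lambda>x. f0 K (w x))" "continuous_on \<Gamma>h (\<lambda>x. deriv (f0 K) (w x))"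
    if "continuous_on \<Gamma>h w" for w
    using continuous_on_compose2[OF continuous_f0[OF K] that]
      continuous_on_compose2[OF continuous_deriv_f0[OF K] that] by auto
  have i: "set_integrable hausdorff2 \<Gamma>h (\<lambda>x. f0 K (v x))" "set_integrable hausdorff2 \<Gamma>h (\<lambda>x. f0 K (u x))"
    "set_integrable hausdorff2 \<Gamma>h (\<lambda>x. deriv (f0 K) (u x) * ?d x)"
    "set_integrable hausdorff2 \<Gamma>h (\<lambda>x. (3 * K\<^sup>2 - 1) / 2 * (?d x * ?d x))"
    by (intro set_integrable_surface_continuous continuous_intros f0 cont)+
  have "(LINT x:\<Gamma>h|hausdorff2. f0 K (v x) - f0 K (u x)) \<le>
      (LINT x:\<Gamma>h|hausdorff2. deriv (f0 K) (u x) * ?d x + (3 * K\<^sup>2 - 1) / 2 * (?d x * ?d x))"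
  proof (rule set_integral_mono)
    show "f0 K (v x) - f0 K (u x) \<le> deriv (f0 K) (u x) * ?d x + (3 * K\<^sup>2 - 1) / 2 * (?d x * ?d x)" for x
      using f0_Taylor_upper_bound[OF K, of "v x" "u x"] by (simp add: power2_eq_square)
  qed (use i in auto)
  also have "\<dots> = (LINT x:\<Gamma>h|hausdorff2. deriv (f0 K) (u x) * ?d x) +
      (3 * K\<^sup>2 - 1) / 2 * (LINT x:\<Gamma>h|hausdorff2. ?d x * ?d x)"
    using set_integral_add(2)[OF i(3,4)] by simp
  finally show ?thesis using set_integral_diff(2)[OF i(1,2)] by (simp add: ip_h_def)
qed

lemma ip_h_nonneg: "0 \<le> ip_h \<T> \<phi>h u u"
  unfolding ip_h_def set_lebesgue_integral_def by (intro Bochner_Integration.integral_nonneg) auto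

lemma ip_h_commute: "ip_h \<T> \<phi>h u v = ip_h \<T> \<phi>h v u"
  by (simp add: ip_h_def mult.commute)

lemma ip_h_divide_left: "ip_h \<T> \<phi>h (\<lambda>x. u x / s) v = ip_h \<T> \<phi>h u v / s"
  by (simp add: ip_h_def)

text \<open>One time step from \<open>u\<close> to \<open>v\<close>. The mass equation is tested with \<open>\<mu>\<close>, the potential
  equation with the increment \<open>v - u\<close>. Their left-hand sides agree up to the factor \<open>\<tau>\<close>, and
  eliminating them leaves an identity in which polarization and the bound on the increment of the
  potential produce the two parts of the energy.\<close>

lemma energy_dissipation:
  assumes u: "u \<in> Vh \<T> \<phi>h k" and v: "v \<in> Vh \<T> \<phi>h k" and \<mu>: "\<mu> \<in> Vh \<T> \<phi>h k"
    and K: "0 < K" and \<tau>: "\<tau> \<noteq> 0" and \<beta>: "(3 * K\<^sup>2 - 1) / 2 \<le> \<beta>"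
    and mass: "ip_h \<T> \<phi>h (\<lambda>x. (v x - u x) / \<tau>) \<mu> = - M * a_h \<T> \<phi>h \<mu> \<mu>"
    and potential: "ip_h \<T> \<phi>h \<mu> (\<lambda>x. v x - u x) =
       \<beta> * \<tau> * ip_h \<T> \<phi>h (\<lambda>x. (v x - u x) / \<tau>) (\<lambda>x. v x - u x)
       + ip_h \<T> \<phi>h (\<lambda>x. deriv (f0 K) (u x)) (\<lambda>x. v x - u x)
       + \<epsilon>\<^sup>2 * a_h \<T> \<phi>h v (\<lambda>x. v x - u x)"
  shows "energy_h \<T> \<phi>h \<epsilon> K v - energy_h \<T> \<phi>h \<epsilon> K u
    + \<epsilon>\<^sup>2 / 2 * a_h \<T> \<phi>h (\<lambda>x. v x - u x) (\<lambda>x. v x - u x) + M * \<tau> * a_h \<T> \<phi>h \<mu> \<mu> \<le> 0"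
proof -
  let ?d = "\<lambda>x. v x - u x"
  let ?I = "ip_h \<T> \<phi>h ?d ?d" and ?F = "ip_h \<T> \<phi>h (\<lambda>x. deriv (f0 K) (u x)) ?d"
  have "- M * \<tau> * a_h \<T> \<phi>h \<mu> \<mu> = ip_h \<T> \<phi>h \<mu> ?d"
    using mass \<tau> by (simp add: ip_h_divide_left ip_h_commute[of ?d \<mu>] field_simps)
  also have "\<dots> = \<beta> * ?I + ?F + \<epsilon>\<^sup>2 * a_h \<T> \<phi>h v ?d"
    using potential \<tau> by (simp add: ip_h_divide_left)
  also have "\<epsilon>\<^sup>2 * a_h \<T> \<phi>h v ?d =
      \<epsilon>\<^sup>2 / 2 * a_h \<T> \<phi>h v v - \<epsilon>\<^sup>2 / 2 * a_h \<T> \<phi>h u u + \<epsilon>\<^sup>2 / 2 * a_h \<T> \<phi>h ?d ?d"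
    using arg_cong[OF a_h_polarization[OF u v], of "\<lambda>t. \<epsilon>\<^sup>2 / 2 * t"]
    by (simp add: right_diff_distrib distrib_left)
  finally have test: "- M * \<tau> * a_h \<T> \<phi>h \<mu> \<mu> = \<beta> * ?I + ?F + \<dots>" .
  have "(3 * K\<^sup>2 - 1) / 2 * ?I \<le> \<beta> * ?I"
    using \<beta> ip_h_nonneg by (rule mult_right_mono)
  then show ?thesis
    using test potential_increment_le[OF K u v] unfolding energy_h_def by linarith
qed

end

section \<open>Energy dissipation of the scheme\<close>

theorem theorem4p1:
  fixes \<Omega> \<O> \<Gamma> :: "(real^3) set"
    and \<phi> \<phi>h :: "real^3 \<Rightarrow> real"
    and \<T> :: "(real^3) set set"
    and lip grad_bound \<sigma> \<kappa> :: real
    and q m :: nat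
    and M \<epsilon> \<tau> \<beta>\<^sub>s K L :: real
    and c_init :: "real^3 \<Rightarrow> real"
    and c \<mu> :: "nat \<Rightarrow> real^3 \<Rightarrow> real"
  assumes "open \<Omega>" and "connected \<Omega>" and "bounded \<Omega>" and "\<Omega> \<noteq> {}"
    and "closed_C2_surface \<Gamma>" and "\<Gamma> = {x \<in> \<Omega>. \<phi> x = 0}"
    and "lip-lipschitz_on (closure \<Omega>) \<phi>"
    and "open \<O>" and "\<Gamma> \<subseteq> \<O>" and "\<O> \<subseteq> \<Omega>" and "grad_bound > 0"
    and "AE x in lborel. x \<in> \<O> \<longrightarrow> \<phi> differentiable (at x) \<and> norm (grad \<phi> (at x)) \<ge> grad_bound"
    and "tetrahedral_mesh \<Omega> \<T>" and "shape_regular \<sigma> \<T>" and "quasi_uniform \<kappa> \<T>"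
    and "q \<ge> 1" and "is_lagrange_interpolant \<T> q \<phi> \<phi>h" and "nondegenerate \<T> \<phi>h"
    and "m \<ge> 1"
    and "M = 1" and "\<epsilon> > 0" and "\<tau> > 0" and "K > 1" and "L = 3 * K\<^sup>2 - 1"
    and "in_H1 \<Gamma> c_init"
    and "is_ritz_projection \<Gamma> \<T> \<phi>h m c_init (c 0)"
    and "\<And>n. c n \<in> Vh \<T> \<phi>h m" and "\<And>n. \<mu> (Suc n) \<in> Vh \<T> \<phi>h m"
    and "\<And>n v. v \<in> Vh \<T> \<phi>h m \<Longrightarrow>
           ip_h \<T> \<phi>h (\<lambda>x. (c (Suc n) x - c n x) / \<tau>) v = - M * a_h \<T> \<phi>h (\<mu> (Suc n)) v"
    and "\<And>n r. r \<in> Vh \<T> \<phi>h m \<Longrightarrow>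
           ip_h \<T> \<phi>h (\<mu> (Suc n)) r =
             \<beta>\<^sub>s * \<tau> * ip_h \<T> \<phi>h (\<lambda>x. (c (Suc n) x - c n x) / \<tau>) r
             + ip_h \<T> \<phi>h (\<lambda>x. deriv (f0 K) (c n x)) r
             + \<epsilon>\<^sup>2 * a_h \<T> \<phi>h (c (Suc n)) r"
    and "\<beta>\<^sub>s \<ge> L / 2"
  shows "(\<forall>n. energy_h \<T> \<phi>h \<epsilon> K (c (Suc n)) - energy_h \<T> \<phi>h \<epsilon> K (c n)
            + \<epsilon>\<^sup>2 / 2 * a_h \<T> \<phi>h (\<lambda>x. c (Suc n) x - c n x) (\<lambda>x. c (Suc n) x - c n x)
            + M * \<tau> * a_h \<T> \<phi>h (\<mu> (Suc n)) (\<mu> (Suc n)) \<le> 0)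
       \<and> (\<forall>n. energy_h \<T> \<phi>h \<epsilon> K (c (Suc n)) \<le> energy_h \<T> \<phi>h \<epsilon> K (c n))"
proof -
  interpret cut_surface_mesh \<Omega> \<T> \<phi>h q
    using assms(4,13,17,18) by unfold_locales (auto simp: is_lagrange_interpolant_def)
  have K: "0 < K" using \<open>K > 1\<close> by simp
  have d: "(\<lambda>x. c (Suc n) x - c n x) \<in> Vh \<T> \<phi>h m" for n
    using assms(27) by (intro fe_space_diff)
  have law: "energy_h \<T> \<phi>h \<epsilon> K (c (Suc n)) - energy_h \<T> \<phi>h \<epsilon> K (c n)
      + \<epsilon>\<^sup>2 / 2 * a_h \<T> \<phi>h (\<lambda>x. c (Suc n) x - c n x) (\<lambda>x. c (Suc n) x - c n x)
      + M * \<tau> * a_h \<T> \<phi>h (\<mu> (Suc n)) (\<mu> (Suc n)) \<le> 0" for n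
  proof (rule energy_dissipation[OF assms(27,27,28) K])
    show "\<tau> \<noteq> 0" using \<open>\<tau> > 0\<close> by simp
    show "(3 * K\<^sup>2 - 1) / 2 \<le> \<beta>\<^sub>s" using assms(24,31) by simp
  qed (rule assms(29)[OF assms(28)], rule assms(30)[OF d])
  have "energy_h \<T> \<phi>h \<epsilon> K (c (Suc n)) \<le> energy_h \<T> \<phi>h \<epsilon> K (c n)" for n
  proof -
    have "0 \<le> \<epsilon>\<^sup>2 / 2 * a_h \<T> \<phi>h (\<lambda>x. c (Suc n) x - c n x) (\<lambda>x. c (Suc n) x - c n x)"
      using a_h_nonneg by simp
    moreover have "0 \<le> M * \<tau> * a_h \<T> \<phi>h (\<mu> (Suc n)) (\<mu> (Suc n))"
      using a_h_nonneg assms(20,22) by simp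
    ultimately show ?thesis using law[of n] by linarith
  qed
  with law show ?thesis by blast
qed

end
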